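(* Let $n\ge 2$ and let $\varphi:\Delta_n\to\mathbb{R}$ be a smooth exponentially concave function such that the Euclidean Hessian of $\Phi=e^{\varphi}$ is strictly negative definite everywhere on $\Delta_n$. Let $T(\cdot\mid\cdot)$ be the L-divergence of $\varphi$ and let $(g,\nabla,\nabla^* )$ be the geometric structure it induces on $\Delta_n$. Let $(p,q,r)\in(\Delta_n)^3$, let $\gamma^*:[0,1]\to\Delta_n$ be the dual geodesic joining $q=\gamma^*(0)$ and $p=\gamma^*(1)$, and let $\gamma:[0,1]\to\Delta_n$ be the primal geodesic joining $q=\gamma(0)$ and $r=\gamma(1)$. Consider the Riemannian angle at $q$ (with respect to $g$) between the two geodesics, i.e. between $\dot\gamma^*(0)$ and $\dot\gamma(0)$. Then the difference $$T(q\mid p)+T(r\mid q)-T(r\mid p)$$ is positive, zero or negative depending on whether this angle is less than, equal to, or greater than $90$ degrees, i.e. depending on whether $\langle\dot\gamma^*(0),\dot\gamma(0)\rangle$ is positive, zero or negative.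
   Context: $\Delta_n=\{p\in\mathbb{R}^n: p_i>0,\ \sum_{i=1}^n p_i=1\}$ is the open unit simplex, regarded as a smooth $(n-1)$-dimensional manifold. Tangent vectors are vectors $v\in\mathbb{R}^n$ with $\sum_i v_i=0$; $\nabla\varphi(p)\cdot v$ denotes the directional derivative of $\varphi$ at $p$ along such $v$, and definiteness of the Hessian is with respect to nonzero tangent vectors. $\varphi$ is exponentially concave if $\Phi=e^{\varphi}$ is concave. L-divergence of $\varphi$: $T(q\mid p)=\log\big(1+\nabla\varphi(p)\cdot(q-p)\big)-(\varphi(q)-\varphi(p))$, $p,q\in\Delta_n$. Induced geometric structure: in any coordinate system $\xi=(\xi_1,\dots,\xi_{n-1})$ of $\Delta_n$, the Riemannian metric $g$ (inner product $\langle\cdot,\cdot\rangle$) is $g_{ij}(\xi)=-\partial_{\xi_i}\partial_{\xi'_j}T(\xi\mid\xi')|_{\xi=\xi'}$; the primal connection $\nabla$ has coefficients $\Gamma_{ijk}(\xi)=-\partial_{\xi_i}\partial_{\xi_j}\partial_{\xi'_k}T(\xi\mid\xi')|_{\xi=\xi'}$; the dual connection $\nabla^*$ has coefficients $\Gamma^*_{ijk}(\xi)=-\partial_{\xi_k}\partial_{\xi'_i}\partial_{\xi'_j}T(\xi\mid\xi')|_{\xi=\xi'}$. Put $\Gamma_{ij}^k=\sum_m\Gamma_{ijm}g^{mk}$, $\Gamma_{ij}^{*k}=\sum_m\Gamma^*_{ijm}g^{mk}$, where $(g^{ij})=(g_{ij})^{-1}$. A smooth curve is a primal (resp. dual) geodesic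 if in coordinates $\ddot\xi_k+\sum_{i,j}\Gamma_{ij}^k(\xi)\dot\xi_i\dot\xi_j=0$ (resp. with $\Gamma_{ij}^{*k}$) for $k=1,\dots,n-1$. Equivalently, for tangent vectors $u,v$ at $p$ in Euclidean representation, $\langle u,v\rangle=u^\top\big(-\Phi(p)^{-1}\,\mathrm{Hess}\,\Phi(p)\big)v$. *)

theory Defs
  imports "HOL-Analysis.Analysis"
begin

definition unit_simplex :: "(real ^ 'n) set" where
  "unit_simplex = {p. (\<forall>i. 0 < p $ i) \<and> (\<Sum>i\<in>UNIV. p $ i) = 1}"

definition tangent_space :: "(real ^ 'n) set" where
  "tangent_space = {v. (\<Sum>i\<in>UNIV. v $ i) = 0}"


text \<open>Derivative along the line through \<open>x\<close> with direction \<open>v\<close>. For \<open>x\<close> in the open simplex and \<open>v\<close>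
  tangent it depends only on the values of \<open>f\<close> on the simplex.\<close>

definition dir_deriv :: "('a::real_normed_vector \<Rightarrow> real) \<Rightarrow> 'a \<Rightarrow> 'a \<Rightarrow> real" where
  "dir_deriv f x v = deriv (\<lambda>t. f (x + t *\<^sub>R v)) 0"

definition hess :: "('a::real_normed_vector \<Rightarrow> real) \<Rightarrow> 'a \<Rightarrow> 'a \<Rightarrow> 'a \<Rightarrow> real" where
  "hess f x u v = dir_deriv (\<lambda>y. dir_deriv f y u) x v"

definition pderivative :: "'m::finite \<Rightarrow> (real ^ 'm \<Rightarrow> real) \<Rightarrow> real ^ 'm \<Rightarrow> real" where
  "pderivative i f x = dir_deriv f x (axis i 1)"


primrec Ck_on ::
    "nat \<Rightarrow> 'a::real_normed_vector set \<Rightarrow> ('a \<Rightarrow> 'b::real_normed_vector) \<Rightarrow> bool" where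
  "Ck_on 0 W f \<longleftrightarrow> continuous_on W f"
| "Ck_on (Suc k) W f \<longleftrightarrow>
     (\<forall>x\<in>W. f differentiable (at x)) \<and> (\<forall>v. Ck_on k W (\<lambda>x. frechet_derivative f (at x) v))"

text \<open>Smoothness on an arbitrary subset of a normed space: local existence of smooth extensions
  to open sets. For the open simplex this is smoothness in the sense of manifolds, and on
  \<open>{0..1}\<close> it is smoothness up to the end points.\<close>

definition smooth_on ::
    "'a::real_normed_vector set \<Rightarrow> ('a \<Rightarrow> 'b::real_normed_vector) \<Rightarrow> bool" where
  "smooth_on S f \<longleftrightarrow>
     (\<forall>x\<in>S. \<exists>W F. open W \<and> x \<in> W \<and> (\<forall>k. Ck_on k W F) \<and> (\<forall>y\<in>W \<inter> S. F y = f y))"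


definition exponentially_concave :: "(real ^ 'n \<Rightarrow> real) \<Rightarrow> bool" where
  "exponentially_concave \<phi> \<longleftrightarrow> concave_on unit_simplex (\<lambda>p. exp (\<phi> p))"

text \<open>\<open>L_divergence \<phi> q p\<close> is \<open>T(q | p)\<close>.\<close>

definition L_divergence :: "(real ^ 'n \<Rightarrow> real) \<Rightarrow> real ^ 'n \<Rightarrow> real ^ 'n \<Rightarrow> real" where
  "L_divergence \<phi> q p = ln (1 + dir_deriv \<phi> p (q - p)) - (\<phi> q - \<phi> p)"


text \<open>A coordinate system \<open>\<xi>\<close> is a diffeomorphism of the simplex onto an open subset of a
  coordinate space. In all that follows \<open>D\<close> is a divergence \<open>D(\<cdot> | \<cdot>)\<close> on the simplex, and the
  arguments \<open>a\<close>, \<open>b\<close>, \<open>x\<close> are coordinate vectors.\<close>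

definition coordinate_system :: "(real ^ 'n \<Rightarrow> real ^ 'm) \<Rightarrow> bool" where
  "coordinate_system \<xi> \<longleftrightarrow>
     inj_on \<xi> unit_simplex \<and> open (\<xi> ` unit_simplex) \<and>
     smooth_on unit_simplex \<xi> \<and> smooth_on (\<xi> ` unit_simplex) (inv_into unit_simplex \<xi>)"

definition in_coords ::
    "(real ^ 'n \<Rightarrow> real ^ 'n \<Rightarrow> real) \<Rightarrow> (real ^ 'n \<Rightarrow> real ^ 'm) \<Rightarrow>
     real ^ 'm \<Rightarrow> real ^ 'm \<Rightarrow> real" where
  "in_coords D \<xi> a b = D (inv_into unit_simplex \<xi> a) (inv_into unit_simplex \<xi> b)"

definition metric_coeff ::
    "(real ^ 'n \<Rightarrow> real ^ 'n \<Rightarrow> real) \<Rightarrow> (real ^ 'n \<Rightarrow> real ^ 'm) \<Rightarrow>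
     real ^ 'm \<Rightarrow> 'm \<Rightarrow> 'm \<Rightarrow> real" where
  "metric_coeff D \<xi> x i j =
     - pderivative i (\<lambda>a. pderivative j (\<lambda>b. in_coords D \<xi> a b) x) x"

definition primal_coeff ::
    "(real ^ 'n \<Rightarrow> real ^ 'n \<Rightarrow> real) \<Rightarrow> (real ^ 'n \<Rightarrow> real ^ 'm) \<Rightarrow>
     real ^ 'm \<Rightarrow> 'm \<Rightarrow> 'm \<Rightarrow> 'm \<Rightarrow> real" where
  "primal_coeff D \<xi> x i j k =
     - pderivative i (pderivative j (\<lambda>a. pderivative k (\<lambda>b. in_coords D \<xi> a b) x)) x"

definition dual_coeff ::
    "(real ^ 'n \<Rightarrow> real ^ 'n \<Rightarrow> real) \<Rightarrow> (real ^ 'n \<Rightarrow> real ^ 'm) \<Rightarrow>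
     real ^ 'm \<Rightarrow> 'm \<Rightarrow> 'm \<Rightarrow> 'm \<Rightarrow> real" where
  "dual_coeff D \<xi> x i j k =
     - pderivative k (\<lambda>a. pderivative i (pderivative j (\<lambda>b. in_coords D \<xi> a b)) x) x"

definition inverse_metric ::
    "(real ^ 'n \<Rightarrow> real ^ 'n \<Rightarrow> real) \<Rightarrow> (real ^ 'n \<Rightarrow> real ^ 'm) \<Rightarrow>
     real ^ 'm \<Rightarrow> real ^ 'm ^ 'm" where
  "inverse_metric D \<xi> x = matrix_inv (\<chi> i j. metric_coeff D \<xi> x i j)"

text \<open>The upper index \<open>k\<close> is the last argument.\<close>

definition primal_christoffel ::
    "(real ^ 'n \<Rightarrow> real ^ 'n \<Rightarrow> real) \<Rightarrow> (real ^ 'n \<Rightarrow> real ^ 'm) \<Rightarrow>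
     real ^ 'm \<Rightarrow> 'm \<Rightarrow> 'm \<Rightarrow> 'm \<Rightarrow> real" where
  "primal_christoffel D \<xi> x i j k =
     (\<Sum>m\<in>UNIV. primal_coeff D \<xi> x i j m * inverse_metric D \<xi> x $ m $ k)"

definition dual_christoffel ::
    "(real ^ 'n \<Rightarrow> real ^ 'n \<Rightarrow> real) \<Rightarrow> (real ^ 'n \<Rightarrow> real ^ 'm) \<Rightarrow>
     real ^ 'm \<Rightarrow> 'm \<Rightarrow> 'm \<Rightarrow> 'm \<Rightarrow> real" where
  "dual_christoffel D \<xi> x i j k =
     (\<Sum>m\<in>UNIV. dual_coeff D \<xi> x i j m * inverse_metric D \<xi> x $ m $ k)"


text \<open>Velocity of a curve parametrized by \<open>{0..1}\<close>, one-sided at the end points.\<close>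

definition velocity :: "(real \<Rightarrow> 'a::real_normed_vector) \<Rightarrow> real \<Rightarrow> 'a" where
  "velocity c t = vector_derivative c (at t within {0..1})"

definition geodesic ::
    "(real ^ 'm \<Rightarrow> 'm \<Rightarrow> 'm \<Rightarrow> 'm \<Rightarrow> real) \<Rightarrow> (real ^ 'n \<Rightarrow> real ^ 'm) \<Rightarrow>
     (real \<Rightarrow> real ^ 'n) \<Rightarrow> bool" where
  "geodesic \<Gamma> \<xi> \<gamma> \<longleftrightarrow>
     smooth_on {0..1} \<gamma> \<and> \<gamma> ` {0..1} \<subseteq> unit_simplex \<and>
     (\<forall>t\<in>{0..1}. \<forall>k.
        velocity (velocity (\<xi> \<circ> \<gamma>)) t $ k +
        (\<Sum>i\<in>UNIV. \<Sum>j\<in>UNIV.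
           \<Gamma> (\<xi> (\<gamma> t)) i j k * velocity (\<xi> \<circ> \<gamma>) t $ i * velocity (\<xi> \<circ> \<gamma>) t $ j) = 0)"

definition primal_geodesic ::
    "(real ^ 'n \<Rightarrow> real ^ 'n \<Rightarrow> real) \<Rightarrow> (real ^ 'n \<Rightarrow> real ^ 'm) \<Rightarrow>
     (real \<Rightarrow> real ^ 'n) \<Rightarrow> bool" where
  "primal_geodesic D \<xi> = geodesic (primal_christoffel D \<xi>) \<xi>"

definition dual_geodesic ::
    "(real ^ 'n \<Rightarrow> real ^ 'n \<Rightarrow> real) \<Rightarrow> (real ^ 'n \<Rightarrow> real ^ 'm) \<Rightarrow>
     (real \<Rightarrow> real ^ 'n) \<Rightarrow> bool" where
  "dual_geodesic D \<xi> = geodesic (dual_christoffel D \<xi>) \<xi>"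


text \<open>Here \<open>u\<close> and \<open>v\<close> are tangent vectors at \<open>p\<close> in Euclidean representation;
  \<open>dir_deriv (\<lambda>y. \<xi> y $ i) p u\<close> is the \<open>i\<close>-th component of \<open>u\<close> in the coordinates \<open>\<xi>\<close>.\<close>

definition riemannian_inner ::
    "(real ^ 'n \<Rightarrow> real ^ 'n \<Rightarrow> real) \<Rightarrow> (real ^ 'n \<Rightarrow> real ^ 'm) \<Rightarrow>
     real ^ 'n \<Rightarrow> real ^ 'n \<Rightarrow> real ^ 'n \<Rightarrow> real" where
  "riemannian_inner D \<xi> p u v =
     (\<Sum>i\<in>UNIV. \<Sum>j\<in>UNIV. metric_coeff D \<xi> (\<xi> p) i j *
        dir_deriv (\<lambda>y. \<xi> y $ i) p u * dir_deriv (\<lambda>y. \<xi> y $ j) p v)"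

text \<open>If \<open>u\<close> or \<open>v\<close> is zero, the quotient is \<open>0\<close> and the angle is \<open>pi / 2\<close>, in accordance with the
  vanishing of the inner product.\<close>

definition riemannian_angle ::
    "(real ^ 'n \<Rightarrow> real ^ 'n \<Rightarrow> real) \<Rightarrow> (real ^ 'n \<Rightarrow> real ^ 'm) \<Rightarrow>
     real ^ 'n \<Rightarrow> real ^ 'n \<Rightarrow> real ^ 'n \<Rightarrow> real" where
  "riemannian_angle D \<xi> p u v =
     arccos (riemannian_inner D \<xi> p u v /
       (sqrt (riemannian_inner D \<xi> p u u) * sqrt (riemannian_inner D \<xi> p v v)))"

end

theory Submission
  imports Defs
begin

text \<open>
  Why the sign of the difference is the sign of the inner product.  Put \<open>\<Phi> = exp \<phi>\<close>, and let
  \<open>support_vector \<phi> p\<close> be the vector \<open>A p\<close> whose inner product with a point \<open>z\<close> of the hyperplane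
  of coordinate sum 1 is the value \<open>\<Phi> p + D\<Phi> p (z - p)\<close> at \<open>z\<close> of the tangent hyperplane to the
  graph of \<open>\<Phi>\<close> at \<open>p\<close>.  By concavity \<open>A p \<bullet> z \<ge> \<Phi> z > 0\<close> on the simplex, and the divergence is
  \<open>T(z | p) = ln (A p \<bullet> z) - \<phi> z\<close> (lemma \<open>L_divergence_eq\<close>).  As \<open>A q \<bullet> q = \<Phi> q\<close>, the terms in \<open>\<phi>\<close>
  cancel and
  \<open>T(q | p) + T(r | q) - T(r | p) = ln ((A q \<bullet> r) / (A q \<bullet> q)) - ln ((A p \<bullet> r) / (A p \<bullet> q))\<close>.
  So the question is how \<open>(A \<bullet> r) / (A \<bullet> q)\<close> changes when the base point of \<open>A\<close> moves from \<open>q\<close> to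
  \<open>p\<close>.

  Up to a term in \<open>z\<close> alone, \<open>T\<close> is the logarithm of a pairing that is linear in each of \<open>A\<close> and
  \<open>z\<close>.  This makes both kinds of geodesics straight up to a scalar factor:

  \<^item> Along a dual geodesic the curve \<open>Y\<close> of support vectors satisfies \<open>Y'' = \<kappa> Y\<close> for a scalar
    function \<open>\<kappa>\<close> (lemma \<open>dual_acceleration\<close>).  Hence \<open>Y \<bullet> r\<close> and \<open>Y \<bullet> q\<close> solve the same linear
    second-order equation, their Wronskian is constant, and the derivative of
    \<open>(Y \<bullet> r) / (Y \<bullet> q)\<close>, which is the Wronskian over \<open>(Y \<bullet> q)\<^sup>2\<close>, keeps the sign that it has at time
    0.  That sign is the one of \<open>Y' 0 \<bullet> (r - q)\<close> (lemma \<open>dual_geodesic_cross_ratio\<close>).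

  \<^item> Along a primal geodesic the acceleration is a multiple of the velocity, namely
    \<open>\<gamma>'' = 2 (ln (\<Phi> \<circ> \<gamma>))' \<gamma>'\<close> (lemma \<open>primal_acceleration\<close>).  Hence \<open>\<gamma>' / (\<Phi> \<circ> \<gamma>)\<^sup>2\<close> is constant, and
    \<open>r - q\<close> is a positive multiple of the initial velocity (lemma \<open>primal_geodesic_direction\<close>).

  The metric is \<open>\<langle>u, v\<rangle> = - (DA u \<bullet> v) / \<Phi>\<close>, so \<open>Y' 0 \<bullet> (r - q)\<close> is a negative multiple of the inner
  product of the two initial velocities, and the signs combine to the claim.  The comparison with
  the angle is the Cauchy-Schwarz inequality for the metric, which is symmetric by equality of mixed
  second derivatives and positive definite by the assumption on the Hessian of \<open>\<Phi>\<close>.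
\<close>

section \<open>Calculus of k times continuously differentiable maps\<close>

lemma frechet_derivative_cong_open:
  assumes "open W" "x \<in> W" "\<And>y. y \<in> W \<Longrightarrow> f y = g y"
  shows "frechet_derivative f (at x) = frechet_derivative g (at x)"
proof -
  have "(f has_derivative D) (at x) \<longleftrightarrow> (g has_derivative D) (at x)" for D
    using has_derivative_transform_within_open[OF _ assms(1,2)] assms(3) by metis
  then show ?thesis by (simp add: frechet_derivative_def)
qed

lemma Ck_on_cong:
  assumes "open W" "\<And>y. y \<in> W \<Longrightarrow> f y = g y" "Ck_on k W f"
  shows "Ck_on k W g"
  using assms(2,3)
proof (induction k arbitrary: f g)
  case 0
  then show ?case by (simp cong: continuous_on_cong)
next
  case (Suc k)
  have "g differentiable (at x)" if "x \<in> W" for x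
  proof -
    from Suc.prems that obtain D where "(f has_derivative D) (at x)" by (auto simp: differentiable_def)
    from has_derivative_transform_within_open[OF this assms(1) that Suc.prems(1)]
    show ?thesis by (auto simp: differentiable_def)
  qed
  moreover have "Ck_on k W (\<lambda>x. frechet_derivative g (at x) v)" for v
  proof (rule Suc.IH)
    show "Ck_on k W (\<lambda>x. frechet_derivative f (at x) v)" using Suc.prems by simp
    show "frechet_derivative f (at y) v = frechet_derivative g (at y) v" if "y \<in> W" for y
      using frechet_derivative_cong_open[OF assms(1) that Suc.prems(1)] by simp
  qed
  ultimately show ?case by simp
qed

text \<open>The form in which derivatives are used below: any explicit formula for the derivative
  serves, in place of the choice term \<open>frechet_derivative\<close>.\<close>

lemma Ck_on_SucI:
  assumes "open W" "\<And>x. x \<in> W \<Longrightarrow> (f has_derivative f' x) (at x)"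
    and "\<And>v. Ck_on k W (\<lambda>x. f' x v)"
  shows "Ck_on (Suc k) W f"
proof -
  have "frechet_derivative f (at x) = f' x" if "x \<in> W" for x
    using frechet_derivative_at[OF assms(2)[OF that]] by simp
  then have "Ck_on k W (\<lambda>x. frechet_derivative f (at x) v)" for v
    by (intro Ck_on_cong[OF assms(1) _ assms(3)]) auto
  then show ?thesis using assms(2) by (auto simp: differentiable_def)
qed

lemma Ck_on_SucD:
  assumes "Ck_on (Suc k) W f" "x \<in> W"
  shows "(f has_derivative frechet_derivative f (at x)) (at x)"
  using assms frechet_derivative_works by auto

lemma Ck_on_lower: "Ck_on (Suc k) W f \<Longrightarrow> Ck_on k W f"
proof (induction k arbitrary: f)
  case 0
  then show ?case
    by (auto intro!: continuous_at_imp_continuous_on differentiable_imp_continuous_within)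
next
  case (Suc k)
  then show ?case by (metis Ck_on.simps(2))
qed

lemma Ck_on_subset: "Ck_on k W f \<Longrightarrow> V \<subseteq> W \<Longrightarrow> Ck_on k V f"
  by (induction k arbitrary: f) (auto intro: continuous_on_subset)

lemma Ck_on_local:
  assumes "\<And>x. x \<in> W \<Longrightarrow> \<exists>V. open V \<and> x \<in> V \<and> Ck_on k V f"
  shows "Ck_on k W f"
  using assms
proof (induction k arbitrary: f)
  case 0
  then show ?case
    by (fastforce intro!: continuous_at_imp_continuous_on simp: continuous_on_eq_continuous_at)
next
  case (Suc k)
  have "Ck_on k W (\<lambda>x. frechet_derivative f (at x) v)" for v
    by (rule Suc.IH) (use Suc.prems in fastforce)
  moreover have "f differentiable (at x)" if "x \<in> W" for x
    using Suc.prems[OF that] by auto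
  ultimately show ?case by auto
qed

lemma Ck_on_const: "open W \<Longrightarrow> Ck_on k W (\<lambda>x. c)"
  by (induction k arbitrary: c) (auto simp del: Ck_on.simps(2) intro: Ck_on_SucI[where f'="\<lambda>_ _. 0"])

lemma Ck_on_linear: "open W \<Longrightarrow> bounded_linear f \<Longrightarrow> Ck_on k W f"
proof (cases k)
  case (Suc j)
  assume "open W" "bounded_linear f"
  then show ?thesis unfolding Suc
    by (intro Ck_on_SucI[where f'="\<lambda>_. f"] Ck_on_const bounded_linear_imp_has_derivative)
qed (auto simp: linear_continuous_on)

lemma Ck_on_add:
  assumes "open W" "Ck_on k W f" "Ck_on k W g"
  shows "Ck_on k W (\<lambda>x. f x + g x)"
  using assms(2,3)
proof (induction k arbitrary: f g)
  case (Suc k)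
  show ?case
    by (rule Ck_on_SucI[OF assms(1) has_derivative_add[OF Ck_on_SucD[OF Suc.prems(1)] Ck_on_SucD[OF Suc.prems(2)]]])
       (use Suc in auto)
qed (auto intro: continuous_on_add)

lemma Ck_on_sum:
  assumes "open W" "\<And>i. i \<in> I \<Longrightarrow> Ck_on k W (f i)"
  shows "Ck_on k W (\<lambda>x. \<Sum>i\<in>I. f i x)"
  using assms(2)
  by (induction I rule: infinite_finite_induct) (auto intro!: Ck_on_const Ck_on_add assms(1))

lemma Ck_on_bilinear:
  assumes "bounded_bilinear pr" "open W" "Ck_on k W f" "Ck_on k W g"
  shows "Ck_on k W (\<lambda>x. pr (f x) (g x))"
  using assms(3,4)
proof (induction k arbitrary: f g)
  case 0
  then show ?case by (auto intro: bounded_bilinear.continuous_on[OF assms(1)])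
next
  case (Suc k)
  show ?case
  proof (rule Ck_on_SucI[OF assms(2) bounded_bilinear.FDERIV[OF assms(1) Ck_on_SucD[OF Suc.prems(1)] Ck_on_SucD[OF Suc.prems(2)]]])
    fix v
    have "Ck_on k W f" "Ck_on k W g" using Suc.prems by (blast intro: Ck_on_lower)+
    then show "Ck_on k W (\<lambda>x. pr (f x) (frechet_derivative g (at x) v) +
         pr (frechet_derivative f (at x) v) (g x))"
      using Suc by (intro Ck_on_add assms Suc.IH) auto
  qed
qed

text \<open>The domain of \<open>f\<close> is finite-dimensional because the induction on
  \<open>k\<close> needs the derivative of \<open>f \<circ> g\<close> in a fixed direction as an
  algebraic expression in \<open>C\<^sup>k\<close> maps. Since \<open>Ck_on\<close> controls
  \<open>f'(y)\<close> only in fixed directions, the vector \<open>g'(x) v\<close> is expanded in a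
  basis.\<close>

lemma Ck_on_compose:
  fixes f :: "'b::euclidean_space \<Rightarrow> 'c::real_normed_vector"
    and g :: "'a::real_normed_vector \<Rightarrow> 'b"
  assumes "open W" "g ` W \<subseteq> V" "Ck_on k W g" "Ck_on k V f"
  shows "Ck_on k W (\<lambda>x. f (g x))"
  using assms(3,4)
proof (induction k arbitrary: f)
  case 0
  then show ?case using assms(2) by (auto intro: continuous_on_compose2)
next
  case (Suc k)
  let ?f' = "\<lambda>y. frechet_derivative f (at y)" and ?g' = "\<lambda>x. frechet_derivative g (at x)"
  have d: "((\<lambda>x. f (g x)) has_derivative (\<lambda>v. \<Sum>b\<in>Basis. (?g' x v \<bullet> b) *\<^sub>R ?f' (g x) b)) (at x)"
    if "x \<in> W" for x
  proof -
    have f: "(f has_derivative ?f' (g x)) (at (g x))"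
      using Suc.prems(2) assms(2) that by (intro Ck_on_SucD) auto
    have l: "linear (?f' (g x))" using f has_derivative_linear by blast
    have rep: "?f' (g x) w = (\<Sum>b\<in>Basis. (w \<bullet> b) *\<^sub>R ?f' (g x) b)" for w
    proof -
      have "?f' (g x) (\<Sum>b\<in>Basis. (w \<bullet> b) *\<^sub>R b) = (\<Sum>b\<in>Basis. (w \<bullet> b) *\<^sub>R ?f' (g x) b)"
        unfolding linear_sum[OF l] linear_cmul[OF l] ..
      then show ?thesis unfolding euclidean_representation .
    qed
    show ?thesis
      by (rule has_derivative_eq_rhs[OF has_derivative_compose[OF Ck_on_SucD[OF Suc.prems(1) that] f]])
         (rule ext, rule rep)
  qed
  show ?case
  proof (rule Ck_on_SucI[OF assms(1) d])
    fix v
    have "Ck_on k W (\<lambda>x. ?f' (g x) b)" for b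
      using Suc.prems by (intro Suc.IH) (auto intro: Ck_on_lower)
    moreover have "Ck_on k W (\<lambda>x. ?g' x v)" using Suc.prems by auto
    ultimately show "Ck_on k W (\<lambda>x. \<Sum>b\<in>Basis. (?g' x v \<bullet> b) *\<^sub>R ?f' (g x) b)"
      by (intro Ck_on_sum Ck_on_bilinear[OF bounded_bilinear_scaleR] 
          Ck_on_bilinear[OF bounded_bilinear_inner] Ck_on_const assms)
  qed auto
qed

lemma Ck_on_exp: "Ck_on k UNIV (exp :: real \<Rightarrow> real)"
proof (induction k)
  case (Suc k)
  show ?case
    by (rule Ck_on_SucI[where f'="\<lambda>x v. exp x * v"])
       (auto intro!: derivative_eq_intros Ck_on_bilinear[OF bounded_bilinear_mult] Ck_on_const Suc)
qed (auto intro: continuous_intros)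

lemma Ck_on_inverse: "Ck_on k (- {0}) (inverse :: real \<Rightarrow> real)"
proof (induction k)
  case (Suc k)
  show ?case
  proof (rule Ck_on_SucI)
    show "(inverse has_derivative (\<lambda>v. (inverse x * inverse x) * (- v))) (at x)" if "x \<in> - {0}" for x :: real
      using that by (auto intro!: derivative_eq_intros)
    show "Ck_on k (- {0}) (\<lambda>x :: real. (inverse x * inverse x) * (- v))" for v
      by (intro Ck_on_bilinear[OF bounded_bilinear_mult] Ck_on_const Suc) auto
  qed auto
qed (auto intro!: continuous_intros)

lemma Ck_on_ln: "Ck_on k {0<..} (ln :: real \<Rightarrow> real)"
proof (cases k)
  case (Suc j)
  show ?thesis unfolding Suc
    by (rule Ck_on_SucI[where f'="\<lambda>x v. inverse x * v"])
       (auto intro!: derivative_eq_intros Ck_on_bilinear[OF bounded_bilinear_mult] Ck_on_const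
         Ck_on_subset[OF Ck_on_inverse] simp: divide_inverse)
qed (auto intro!: continuous_intros)

lemma has_vector_derivative_along_line:
  assumes "(f has_derivative f') (at (z + a *\<^sub>R u))"
  shows "((\<lambda>t. f (z + t *\<^sub>R u)) has_vector_derivative f' u) (at a)"
proof -
  have "((\<lambda>t. z + t *\<^sub>R u) has_derivative (\<lambda>h. h *\<^sub>R u)) (at a)"
    by (auto intro!: derivative_eq_intros)
  from has_derivative_compose[OF this, of f f'] assms
  show ?thesis
    by (simp add: has_vector_derivative_def linear_cmul[OF has_derivative_linear[OF assms]])
qed

text \<open>Schwarz's theorem. The second difference of \<open>f\<close> over the parallelogram
  spanned by \<open>s u\<close> and \<open>s v\<close> does not change when \<open>u\<close> and
  \<open>v\<close> are exchanged; by the mean value theorem, used once in each direction, it is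
  \<open>s\<^sup>2\<close> times a mixed derivative at a nearby point. Let \<open>s\<close> tend to
  0.\<close>

lemma second_derivative_symmetric:
  fixes f :: "'a::real_normed_vector \<Rightarrow> real"
  assumes W: "open W" "x \<in> W" and f: "Ck_on 2 W f"
  shows "frechet_derivative (\<lambda>y. frechet_derivative f (at y) u) (at x) v =
         frechet_derivative (\<lambda>y. frechet_derivative f (at y) v) (at x) u"
    (is "?D u v x = ?D v u x")
proof -
  define F where "F v y = frechet_derivative f (at y) v" for v y
  define H where "H u v y = frechet_derivative (F u) (at y) v" for u v y
  have f1: "(f has_derivative (\<lambda>v. F v y)) (at y)" if "y \<in> W" for y
    using f that Ck_on_SucD[of 1 W f y] by (simp add: F_def[abs_def] numeral_2_eq_2)
  have f2: "(F u has_derivative (\<lambda>v. H u v y)) (at y)" if "y \<in> W" for u y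
    using f that Ck_on_SucD[of 0 W "F u" y] by (simp add: F_def[abs_def] H_def[abs_def] numeral_2_eq_2)
  have f3: "continuous_on W (H u v)" for u v
    using f by (simp add: F_def[abs_def] H_def[abs_def] numeral_2_eq_2)
  obtain e0 where e0: "e0 > 0" "ball x e0 \<subseteq> W" using W by (meson open_contains_ball)
  have mvt: "\<exists>z. dist x z \<le> s * norm u + s * norm v \<and>
        f (x + s *\<^sub>R u + s *\<^sub>R v) - f (x + s *\<^sub>R u) - f (x + s *\<^sub>R v) + f x = s * s * H u v z"
    if s: "s > 0" "s * norm u + s * norm v < e0" for u v s
  proof -
    have bound: "norm (a *\<^sub>R u + b *\<^sub>R v) \<le> s * norm u + s * norm v"
      if "0 \<le> a" "a \<le> s" "0 \<le> b" "b \<le> s" for a b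
      using that by (intro norm_triangle_le add_mono) (auto intro: mult_right_mono)
    have inW: "x + a *\<^sub>R u + b *\<^sub>R v \<in> W" if "0 \<le> a" "a \<le> s" "0 \<le> b" "b \<le> s" for a b
    proof -
      have "dist x (x + a *\<^sub>R u + b *\<^sub>R v) < e0"
        using bound[OF that] s by (simp add: dist_norm norm_minus_commute algebra_simps)
      then show ?thesis using e0 by auto
    qed
    \<comment> \<open>the second difference is first a difference of values of \<open>k\<close>, then one of values of \<open>l\<close>\<close>
    define k where "k a = f (x + s *\<^sub>R v + a *\<^sub>R u) - f (x + a *\<^sub>R u)" for a
    have dk: "(k has_real_derivative F u (x + s *\<^sub>R v + a *\<^sub>R u) - F u (x + a *\<^sub>R u)) (at a)"
      if "0 \<le> a" "a \<le> s" for a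
      unfolding k_def has_real_derivative_iff_has_vector_derivative
      using inW[OF that, of s] inW[OF that, of 0] s
      by (intro has_vector_derivative_diff has_vector_derivative_along_line f1)
         (auto simp: algebra_simps)
    obtain a where a: "0 < a" "a < s"
      "k s - k 0 = s * (F u (x + s *\<^sub>R v + a *\<^sub>R u) - F u (x + a *\<^sub>R u))"
      using MVT2[OF s(1) dk] by auto
    define l where "l b = F u (x + a *\<^sub>R u + b *\<^sub>R v)" for b
    have dl: "(l has_real_derivative H u v (x + a *\<^sub>R u + b *\<^sub>R v)) (at b)"
      if "0 \<le> b" "b \<le> s" for b
      unfolding l_def has_real_derivative_iff_has_vector_derivative
      using inW[of a b] a that by (intro has_vector_derivative_along_line f2) auto
    obtain b where b: "0 < b" "b < s" "l s - l 0 = s * H u v (x + a *\<^sub>R u + b *\<^sub>R v)"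
      using MVT2[OF s(1) dl] by auto
    show ?thesis
    proof (intro exI conjI)
      show "dist x (x + a *\<^sub>R u + b *\<^sub>R v) \<le> s * norm u + s * norm v"
        using bound[of a b] a b by (simp add: dist_norm norm_minus_commute algebra_simps)
      show "f (x + s *\<^sub>R u + s *\<^sub>R v) - f (x + s *\<^sub>R u) - f (x + s *\<^sub>R v) + f x = s * s * H u v (x + a *\<^sub>R u + b *\<^sub>R v)"
        using a(3) b(3) by (simp add: k_def l_def algebra_simps)
    qed
  qed
  have "H u v x = H v u x"
  proof (rule ccontr)
    assume ne: "H u v x \<noteq> H v u x"
    define e where "e = \<bar>H u v x - H v u x\<bar> / 2"
    have e: "e > 0" using ne by (simp add: e_def)
    have cont: "\<exists>d>0. \<forall>z. dist x z < d \<longrightarrow> \<bar>H u v z - H u v x\<bar> < e" for u v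
      using f3[of u v] W e
      by (auto simp: continuous_on_eq_continuous_at continuous_at_eps_delta dist_real_def
          dist_commute)
    obtain d1 where d1: "d1 > 0" "\<And>z. dist x z < d1 \<Longrightarrow> \<bar>H u v z - H u v x\<bar> < e" using cont by meson
    obtain d2 where d2: "d2 > 0" "\<And>z. dist x z < d2 \<Longrightarrow> \<bar>H v u z - H v u x\<bar> < e" using cont by meson
    define m where "m = min e0 (min d1 d2)"
    \<comment> \<open>the 1 keeps the denominator positive if \<open>u\<close> and \<open>v\<close> are 0\<close>
    define s where "s = m / (2 * (norm u + norm v + 1))"
    have m: "m > 0" using e0 d1 d2 by (simp add: m_def)
    have s: "s > 0" unfolding s_def using m by (intro divide_pos_pos) (auto intro: add_nonneg_pos)
    have "s * (norm u + norm v) \<le> s * (norm u + norm v + 1)" using s by (intro mult_left_mono) auto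
    also have "\<dots> = m / 2" using add_nonneg_pos[of "norm u + norm v" 1] by (simp add: s_def field_simps)
    also have "\<dots> < m" using m by simp
    finally have sm: "s * norm u + s * norm v < m" by (simp add: algebra_simps)
    obtain z1 where z1: "dist x z1 \<le> s * norm u + s * norm v"
      "f (x + s *\<^sub>R u + s *\<^sub>R v) - f (x + s *\<^sub>R u) - f (x + s *\<^sub>R v) + f x = s * s * H u v z1"
      using mvt[OF s, of u v] sm by (auto simp: m_def)
    obtain z2 where z2: "dist x z2 \<le> s * norm v + s * norm u"
      "f (x + s *\<^sub>R v + s *\<^sub>R u) - f (x + s *\<^sub>R v) - f (x + s *\<^sub>R u) + f x = s * s * H v u z2"
      using mvt[OF s, of v u] sm by (auto simp: m_def add.commute)
    have "s * s * H u v z1 = s * s * H v u z2"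
      using z1(2) z2(2) by (simp add: algebra_simps)
    then have "H u v z1 = H v u z2" using s by simp
    moreover have "\<bar>H u v z1 - H u v x\<bar> < e" "\<bar>H v u z2 - H v u x\<bar> < e"
      using d1(2)[of z1] d2(2)[of z2] z1(1) z2(1) sm by (auto simp: m_def)
    ultimately show False unfolding e_def by argo
  qed
  then show ?thesis by (simp add: H_def F_def[abs_def])
qed

lemma smooth_on_compose:
  fixes f :: "'b::euclidean_space \<Rightarrow> 'c::real_normed_vector"
    and g :: "'a::real_normed_vector \<Rightarrow> 'b"
  assumes "smooth_on S g" "smooth_on T f" "g ` S \<subseteq> T"
  shows "smooth_on S (\<lambda>x. f (g x))"
  unfolding smooth_on_def
proof
  fix x assume x: "x \<in> S"
  from assms(1) x obtain V G where V: "open V" "x \<in> V" "\<And>k. Ck_on k V G" "\<And>y. y \<in> V \<inter> S \<Longrightarrow> G y = g y"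
    unfolding smooth_on_def by meson
  have "g x \<in> T" using assms(3) x by auto
  with assms(2) obtain W F where W: "open W" "g x \<in> W" "\<And>k. Ck_on k W F" "\<And>y. y \<in> W \<inter> T \<Longrightarrow> F y = f y"
    unfolding smooth_on_def by meson
  have "continuous_on V G" using V(3)[of 0] by simp
  then have "open (G -` W \<inter> V)" using V(1) W(1) continuous_on_open_vimage by blast
  moreover have "x \<in> G -` W \<inter> V" using V W x by auto
  moreover have "Ck_on k (G -` W \<inter> V) (\<lambda>x. F (G x))" for k
    by (rule Ck_on_compose[OF \<open>open (G -` W \<inter> V)\<close> _ Ck_on_subset[OF V(3)] W(3)]) auto
  moreover have "\<forall>y\<in>(G -` W \<inter> V) \<inter> S. F (G y) = f (g y)"
    using V(4) W(4) assms(3) by auto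
  ultimately show "\<exists>W F. open W \<and> x \<in> W \<and> (\<forall>k. Ck_on k W F) \<and> (\<forall>y\<in>W \<inter> S. F y = f (g y))"
    by blast
qed

lemma smooth_on_imp_Ck_on:
  assumes "open S" "smooth_on S f"
  shows "Ck_on k S f"
proof (rule Ck_on_local)
  fix x assume x: "x \<in> S"
  with assms(2) obtain W F where W: "open W" "x \<in> W" "\<And>k. Ck_on k W F" "\<And>y. y \<in> W \<inter> S \<Longrightarrow> F y = f y"
    unfolding smooth_on_def by meson
  have "Ck_on k (W \<inter> S) f"
    by (rule Ck_on_cong[OF _ W(4) Ck_on_subset[OF W(3)]]) (use W assms in auto)
  then show "\<exists>V. open V \<and> x \<in> V \<and> Ck_on k V f"
    using W assms x by (intro exI[of _ "W \<inter> S"]) auto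
qed

section \<open>Directional and partial derivatives\<close>

lemma dir_deriv_eqI:
  assumes "(f has_derivative f') (at x)"
  shows "dir_deriv f x v = f' v"
proof -
  have "((\<lambda>t. f (x + t *\<^sub>R v)) has_real_derivative f' v) (at 0)"
    unfolding has_real_derivative_iff_has_vector_derivative
    using assms by (intro has_vector_derivative_along_line) simp
  then show ?thesis by (simp add: dir_deriv_def DERIV_imp_deriv)
qed

lemma dir_deriv_cong:
  assumes "eventually (\<lambda>t. f (x + t *\<^sub>R v) = g (x + t *\<^sub>R v)) (nhds 0)"
  shows "dir_deriv f x v = dir_deriv g x v"
  unfolding dir_deriv_def by (rule deriv_cong_ev[OF assms refl])

lemma eventually_line_in_open:
  fixes x v :: "'a::real_normed_vector"
  assumes "open W" "x \<in> W"
  shows "eventually (\<lambda>t. x + t *\<^sub>R v \<in> W) (nhds 0)"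
proof -
  have "((\<lambda>t. x + t *\<^sub>R v) \<longlongrightarrow> x + 0 *\<^sub>R v) (nhds 0)"
    by (intro tendsto_intros filterlim_ident)
  then show ?thesis using assms by (intro topological_tendstoD) auto
qed

lemma pderivative_eqI:
  "(f has_derivative f') (at x) \<Longrightarrow> pderivative i f x = f' (axis i 1)"
  unfolding pderivative_def by (rule dir_deriv_eqI)

lemma pderivative_cong:
  assumes "open W" "x \<in> W" "\<And>y. y \<in> W \<Longrightarrow> f y = g y"
  shows "pderivative i f x = pderivative i g x"
  unfolding pderivative_def
  by (intro dir_deriv_cong eventually_mono[OF eventually_line_in_open[OF assms(1,2)]] assms(3))

lemma linear_axis_expansion:
  fixes f :: "real ^ 'm \<Rightarrow> 'b::real_vector"
  assumes "linear f"
  shows "f v = (\<Sum>i\<in>UNIV. v $ i *\<^sub>R f (axis i 1))"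
proof -
  have "f (\<Sum>i\<in>UNIV. v $ i *\<^sub>R axis i 1) = (\<Sum>i\<in>UNIV. v $ i *\<^sub>R f (axis i 1))"
    unfolding linear_sum[OF assms] linear_cmul[OF assms] ..
  moreover have "(\<Sum>i\<in>UNIV. v $ i *\<^sub>R axis i 1) = v"
    using basis_expansion[of v] by (simp add: scalar_mult_eq_scaleR)
  ultimately show ?thesis by simp
qed

lemma Ck_on_pderivative:
  assumes "open U" "Ck_on (Suc k) U P"
  shows "Ck_on k U (pderivative j P)"
proof (rule Ck_on_cong[OF assms(1)])
  show "Ck_on k U (\<lambda>y. frechet_derivative P (at y) (axis j 1))" using assms(2) by simp
  show "frechet_derivative P (at y) (axis j 1) = pderivative j P y" if "y \<in> U" for y
    using pderivative_eqI[OF Ck_on_SucD[OF assms(2) that]] by simp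
qed

section \<open>Velocity and acceleration of curves\<close>

lemma velocity_eqI:
  assumes "(c has_vector_derivative d) (at t within {0..1})" "t \<in> {0..1}"
  shows "velocity c t = d"
  unfolding velocity_def
  using vector_derivative_within_cbox[of 0 1 t c d] assms by simp

text \<open>On a neighbourhood of each time, a curve that is smooth up to the end points agrees with
  an extension \<open>F\<close> to an open set; its one-sided velocity is then the ordinary
  derivative of \<open>F\<close>.\<close>

lemma smooth_curve_extension:
  assumes "smooth_on {0..1} c" "t \<in> {0..1}"
  obtains W F where "open W" "t \<in> W" "\<And>k. Ck_on k W F" "\<And>s. s \<in> W \<inter> {0..1} \<Longrightarrow> F s = c s"
    "\<And>s. s \<in> W \<inter> {0..1} \<Longrightarrow>
      (c has_vector_derivative frechet_derivative F (at s) 1) (at s within {0..1})"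
proof -
  from assms obtain W F where W: "open W" "t \<in> W" "\<And>k. Ck_on k W F" "\<And>s. s \<in> W \<inter> {0..1} \<Longrightarrow> F s = c s"
    unfolding smooth_on_def by meson
  have "(c has_vector_derivative frechet_derivative F (at s) 1) (at s within {0..1})"
    if s: "s \<in> W \<inter> {0..1}" for s
  proof -
    have "(F has_derivative frechet_derivative F (at s)) (at s)"
      using Ck_on_SucD[OF W(3)] s by blast
    then have "(F has_vector_derivative frechet_derivative F (at s) 1) (at s)"
      using has_vector_derivative_along_line[of F _ 0 s 1] by simp
    then have F: "(F has_vector_derivative frechet_derivative F (at s) 1) (at s within {0..1})"
      by (rule has_vector_derivative_at_within)
    obtain d where d: "d > 0" "ball s d \<subseteq> W" using W(1) s by (meson IntD1 open_contains_ball)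
    show ?thesis
      by (rule has_vector_derivative_transform_within[OF F d(1)])
         (use s d(2) W(4) in \<open>auto simp: dist_commute subset_iff\<close>)
  qed
  with W that show thesis by blast
qed

lemma has_vector_derivative_velocity:
  assumes "smooth_on {0..1} c" "t \<in> {0..1}"
  shows "(c has_vector_derivative velocity c t) (at t within {0..1})"
  using smooth_curve_extension[OF assms] velocity_eqI assms(2) by (metis IntI)

lemma smooth_on_velocity:
  assumes "smooth_on {0..1} c"
  shows "smooth_on {0..1} (velocity c)"
  unfolding smooth_on_def
proof
  fix t :: real assume t: "t \<in> {0..1}"
  from smooth_curve_extension[OF assms t] obtain W F where
    W: "open W" "t \<in> W" "\<And>k. Ck_on k W F"
    and d: "\<And>s. s \<in> W \<inter> {0..1} \<Longrightarrow>
      (c has_vector_derivative frechet_derivative F (at s) 1) (at s within {0..1})"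
    by metis
  have "Ck_on k W (\<lambda>s. frechet_derivative F (at s) 1)" for k
    using W(3)[of "Suc k"] by simp
  moreover have "\<forall>s\<in>W \<inter> {0..1}. frechet_derivative F (at s) 1 = velocity c s"
    using velocity_eqI[OF d] by auto
  ultimately show "\<exists>W F. open W \<and> t \<in> W \<and> (\<forall>k. Ck_on k W F) \<and> (\<forall>s\<in>W \<inter> {0..1}. F s = velocity c s)"
    using W by blast
qed

lemma velocity_cong:
  assumes "\<And>s. s \<in> {0..1} \<Longrightarrow> c s = d s" "t \<in> {0..1}"
  shows "velocity c t = velocity d t"
proof -
  have "(c has_vector_derivative v) (at t within {0..1}) \<longleftrightarrow>
        (d has_vector_derivative v) (at t within {0..1})" for v
    using has_vector_derivative_transform[OF assms(2), of c d]
      has_vector_derivative_transform[OF assms(2), of d c] assms(1) by metis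
  then show ?thesis by (simp add: velocity_def vector_derivative_def)
qed

lemma velocity_compose:
  fixes P :: "real ^ 'm \<Rightarrow> real"
  assumes U: "open U" and P: "Ck_on (Suc 0) U P"
    and c: "smooth_on {0..1} c" "c ` {0..1} \<subseteq> U" and t: "t \<in> {0..1}"
  shows "((\<lambda>s. P (c s)) has_vector_derivative
           (\<Sum>j\<in>UNIV. pderivative j P (c t) * velocity c t $ j)) (at t within {0..1})"
proof -
  have d: "(P has_derivative frechet_derivative P (at (c t))) (at (c t))"
    by (rule Ck_on_SucD[OF P]) (use c t in auto)
  have "((P \<circ> c) has_vector_derivative frechet_derivative P (at (c t)) (velocity c t)) (at t within {0..1})"
    by (rule vector_derivative_diff_chain_within[OF has_vector_derivative_velocity[OF c(1) t]
        has_derivative_at_withinI[OF d]])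
  then show ?thesis
    using linear_axis_expansion[OF has_derivative_linear[OF d], of "velocity c t"]
    by (simp add: pderivative_eqI[OF d] o_def mult.commute)
qed

text \<open>The left-hand side of the geodesic equation, with lowered index, has the form of the
  right-hand side here. So the geodesic equations are statements on second time derivatives of
  functions along the curve, and these are computed below without coordinates.\<close>

lemma second_velocity_compose:
  fixes P :: "real ^ 'm \<Rightarrow> real"
  assumes U: "open U" and P: "Ck_on 2 U P"
    and c: "smooth_on {0..1} c" "c ` {0..1} \<subseteq> U" and t: "t \<in> {0..1}"
  shows "velocity (velocity (\<lambda>s. P (c s))) t =
     (\<Sum>j\<in>UNIV. pderivative j P (c t) * velocity (velocity c) t $ j) +
     (\<Sum>i\<in>UNIV. \<Sum>j\<in>UNIV. pderivative i (pderivative j P) (c t) * velocity c t $ i * velocity c t $ j)"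
proof (rule velocity_eqI[OF _ t])
  have P2: "Ck_on (Suc (Suc 0)) U P" using P by (simp only: numeral_2_eq_2)
  have 1: "velocity (\<lambda>s. P (c s)) s = (\<Sum>j\<in>UNIV. pderivative j P (c s) * velocity c s $ j)"
    if "s \<in> {0..1}" for s
    using velocity_compose[OF U Ck_on_lower[OF P2] c that] that by (rule velocity_eqI)
  have 2: "((\<lambda>s. velocity c s $ j) has_vector_derivative velocity (velocity c) t $ j) (at t within {0..1})" for j
    by (intro bounded_linear.has_vector_derivative[OF bounded_linear_vec_nth]
        has_vector_derivative_velocity smooth_on_velocity c t)
  have 3: "((\<lambda>s. \<Sum>j\<in>UNIV. pderivative j P (c s) * velocity c s $ j) has_vector_derivative
      (\<Sum>j\<in>UNIV. pderivative j P (c t) * velocity (velocity c) t $ j +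
        (\<Sum>i\<in>UNIV. pderivative i (pderivative j P) (c t) * velocity c t $ i) * velocity c t $ j))
      (at t within {0..1})"
    by (intro has_vector_derivative_sum has_vector_derivative_mult 2
        velocity_compose[OF U Ck_on_pderivative[OF U P2] c t])
  have "(\<Sum>j\<in>UNIV. pderivative j P (c t) * velocity (velocity c) t $ j +
        (\<Sum>i\<in>UNIV. pderivative i (pderivative j P) (c t) * velocity c t $ i) * velocity c t $ j) =
     (\<Sum>j\<in>UNIV. pderivative j P (c t) * velocity (velocity c) t $ j) +
     (\<Sum>i\<in>UNIV. \<Sum>j\<in>UNIV. pderivative i (pderivative j P) (c t) * velocity c t $ i * velocity c t $ j)"
    by (subst sum.swap) (simp add: sum.distrib sum_distrib_right)
  with 3 show "(velocity (\<lambda>s. P (c s)) has_vector_derivative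
     (\<Sum>j\<in>UNIV. pderivative j P (c t) * velocity (velocity c) t $ j) +
     (\<Sum>i\<in>UNIV. \<Sum>j\<in>UNIV. pderivative i (pderivative j P) (c t) * velocity c t $ i * velocity c t $ j))
     (at t within {0..1})"
    using has_vector_derivative_transform[OF t 1] by simp
qed

lemma has_real_derivative_inner_velocity:
  assumes "smooth_on {0..1} c" "t \<in> {0..1}"
  shows "((\<lambda>s. c s \<bullet> z) has_real_derivative velocity c t \<bullet> z) (at t within {0..1})"
  unfolding has_real_derivative_iff_has_vector_derivative
  by (intro bounded_linear.has_vector_derivative[OF bounded_linear_inner_left] has_vector_derivative_velocity assms)

lemma velocity_realI:
  assumes "(c has_real_derivative d) (at t within {0..1})" "t \<in> {0..1}"
  shows "velocity c t = d"
  using assms by (intro velocity_eqI) (simp_all add: has_real_derivative_iff_has_vector_derivative)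

lemma second_velocity_realI:
  assumes "\<And>s. s \<in> {0..1} \<Longrightarrow> (c has_real_derivative d s) (at s within {0..1})"
    and "(d has_real_derivative e) (at t within {0..1})" "t \<in> {0..1}"
  shows "velocity (velocity c) t = e"
proof (rule velocity_eqI[OF _ assms(3)])
  have "velocity c s = d s" if "s \<in> {0..1}" for s using velocity_realI[OF assms(1)] that by blast
  then show "(velocity c has_vector_derivative e) (at t within {0..1})"
    using assms(2,3) unfolding has_real_derivative_iff_has_vector_derivative
    by (intro has_vector_derivative_transform[of t "{0..1}" "velocity c" d]) auto
qed

text \<open>Applied with \<open>\<beta>\<close> a derivative of the support vector at \<open>c
  t\<close>, which annihilates \<open>c t\<close>.\<close>

lemma second_velocity_quotient:
  assumes c: "smooth_on {0..1} c" and t: "t \<in> {0..1}"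
    and pos: "\<And>s. s \<in> {0..1} \<Longrightarrow> 0 < c s \<bullet> \<alpha>" and zero: "c t \<bullet> \<beta> = 0"
  shows "velocity (velocity (\<lambda>s. (c s \<bullet> \<beta>) / (c s \<bullet> \<alpha>))) t =
     (velocity (velocity c) t \<bullet> \<beta>) / (c t \<bullet> \<alpha>)
       - 2 * (velocity c t \<bullet> \<beta>) * (velocity c t \<bullet> \<alpha>) / (c t \<bullet> \<alpha>)\<^sup>2"
proof (rule second_velocity_realI[OF _ _ t])
  note d = has_real_derivative_inner_velocity[OF c]
    has_real_derivative_inner_velocity[OF smooth_on_velocity[OF c]]
  show "((\<lambda>s. (c s \<bullet> \<beta>) / (c s \<bullet> \<alpha>)) has_real_derivative
      ((velocity c s \<bullet> \<beta>) * (c s \<bullet> \<alpha>) - (c s \<bullet> \<beta>) * (velocity c s \<bullet> \<alpha>)) / ((c s \<bullet> \<alpha>) * (c s \<bullet> \<alpha>)))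
      (at s within {0..1})" if "s \<in> {0..1}" for s
    using pos[OF that] by (intro DERIV_divide d that) auto
  show "((\<lambda>s. ((velocity c s \<bullet> \<beta>) * (c s \<bullet> \<alpha>) - (c s \<bullet> \<beta>) * (velocity c s \<bullet> \<alpha>)) / ((c s \<bullet> \<alpha>) * (c s \<bullet> \<alpha>)))
     has_real_derivative (velocity (velocity c) t \<bullet> \<beta>) / (c t \<bullet> \<alpha>)
       - 2 * (velocity c t \<bullet> \<beta>) * (velocity c t \<bullet> \<alpha>) / (c t \<bullet> \<alpha>)\<^sup>2) (at t within {0..1})"
    by (rule derivative_eq_intros d t refl)+
       (use pos[OF t] zero in \<open>auto simp: field_simps power2_eq_square\<close>)
qed

lemma second_velocity_ln:
  assumes c: "smooth_on {0..1} c" and t: "t \<in> {0..1}"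
    and pos: "\<And>s. s \<in> {0..1} \<Longrightarrow> 0 < c s \<bullet> \<alpha>"
  shows "velocity (velocity (\<lambda>s. ln (c s \<bullet> \<alpha>) - k)) t =
     (velocity (velocity c) t \<bullet> \<alpha>) / (c t \<bullet> \<alpha>) - (velocity c t \<bullet> \<alpha>)\<^sup>2 / (c t \<bullet> \<alpha>)\<^sup>2"
proof (rule second_velocity_realI[OF _ _ t])
  note d = has_real_derivative_inner_velocity[OF c]
    has_real_derivative_inner_velocity[OF smooth_on_velocity[OF c]]
  show "((\<lambda>s. ln (c s \<bullet> \<alpha>) - k) has_real_derivative (velocity c s \<bullet> \<alpha>) / (c s \<bullet> \<alpha>))
      (at s within {0..1})" if "s \<in> {0..1}" for s
    using pos[OF that] d(1)[OF that, of \<alpha>] by (auto intro!: derivative_eq_intros)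
  show "((\<lambda>s. (velocity c s \<bullet> \<alpha>) / (c s \<bullet> \<alpha>)) has_real_derivative
      (velocity (velocity c) t \<bullet> \<alpha>) / (c t \<bullet> \<alpha>) - (velocity c t \<bullet> \<alpha>)\<^sup>2 / (c t \<bullet> \<alpha>)\<^sup>2) (at t within {0..1})"
    by (rule derivative_eq_intros d t refl)+
       (use pos[OF t] in \<open>auto simp: field_simps power2_eq_square\<close>)
qed

lemma mvt_within_unit_interval:
  assumes "\<And>s. s \<in> {0..1} \<Longrightarrow> (f has_real_derivative f' s) (at s within {0..1})"
  obtains s where "s \<in> {0..1}" "f 1 - f 0 = f' s"
proof -
  have "\<exists>s\<in>{0<..<1}. f 1 - f 0 = (\<lambda>h. f' s * h) (1 - 0)"
    using assms by (intro mvt_simple) (auto simp: has_field_derivative_def)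
  then obtain s where "s \<in> {0<..<1}" "f 1 - f 0 = f' s" by auto
  with that[of s] show thesis by simp
qed

lemma constant_on_unit_interval:
  fixes f :: "real \<Rightarrow> real"
  assumes "\<And>s. s \<in> {0..1} \<Longrightarrow> (f has_real_derivative 0) (at s within {0..1})" "s \<in> {0..1}"
  shows "f s = f 0"
  using has_field_derivative_zero_constant[of "{0..1}" f] assms
  by (metis atLeastAtMost_iff convex_real_interval(5) order_refl zero_less_one_class.zero_le_one)

section \<open>Linear algebra of the metric\<close>

text \<open>The inverse metric in the Christoffel symbols cancels when the upper index of the
  geodesic equation is lowered.\<close>

lemma lower_acceleration_index:
  fixes G :: "real ^ 'm ^ 'm"
  assumes "invertible G"
    and "\<And>k. a $ k + (\<Sum>i\<in>UNIV. \<Sum>j\<in>UNIV. (\<Sum>m\<in>UNIV. C i j m * matrix_inv G $ m $ k) * v $ i * v $ j) = 0"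
  shows "(\<Sum>k\<in>UNIV. G $ k $ l * a $ k) + (\<Sum>i\<in>UNIV. \<Sum>j\<in>UNIV. C i j l * v $ i * v $ j) = 0"
proof -
  define c where "c = (\<chi> m. \<Sum>i\<in>UNIV. \<Sum>j\<in>UNIV. C i j m * v $ i * v $ j)"
  have "(\<Sum>i\<in>UNIV. \<Sum>j\<in>UNIV. (\<Sum>m\<in>UNIV. C i j m * matrix_inv G $ m $ k) * v $ i * v $ j)
      = (c v* matrix_inv G) $ k" for k
  proof -
    have "(\<Sum>i\<in>UNIV. \<Sum>j\<in>UNIV. (\<Sum>m\<in>UNIV. C i j m * matrix_inv G $ m $ k) * v $ i * v $ j)
       = (\<Sum>i\<in>UNIV. \<Sum>j\<in>UNIV. \<Sum>m\<in>UNIV. (C i j m * v $ i * v $ j) * matrix_inv G $ m $ k)"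
      by (simp add: sum_distrib_left sum_distrib_right mult_ac)
    also have "\<dots> = (\<Sum>i\<in>UNIV. \<Sum>m\<in>UNIV. \<Sum>j\<in>UNIV. (C i j m * v $ i * v $ j) * matrix_inv G $ m $ k)"
      by (intro sum.cong sum.swap refl)
    also have "\<dots> = (\<Sum>m\<in>UNIV. \<Sum>i\<in>UNIV. \<Sum>j\<in>UNIV. (C i j m * v $ i * v $ j) * matrix_inv G $ m $ k)"
      by (rule sum.swap)
    finally show ?thesis
      by (simp add: vector_matrix_mult_def c_def sum_distrib_left sum_distrib_right mult_ac)
  qed
  with assms(2) have "a + c v* matrix_inv G = 0" by (simp add: vec_eq_iff)
  then have "a = - (c v* matrix_inv G)" by (simp add: eq_neg_iff_add_eq_0)
  then have "a v* G = - ((c v* matrix_inv G) v* G)"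
    by (simp add: vec_eq_iff vector_matrix_mult_def sum_negf)
  also have "\<dots> = - c" 
    using someI_ex[OF assms(1)[unfolded invertible_def]]
    by (simp add: vector_matrix_mul_assoc matrix_inv_def)
  finally have "(a v* G) $ l + c $ l = 0" by simp
  then show ?thesis by (simp add: vector_matrix_mult_def c_def mult.commute[of "a $ _"])
qed

lemma cauchy_schwarz_bilinear:
  fixes g :: "'a::real_vector \<Rightarrow> 'a \<Rightarrow> real"
  assumes lin: "\<And>v. linear (\<lambda>u. g u v)" and sym: "\<And>u v. g u v = g v u"
    and pos: "\<And>u. u \<noteq> 0 \<Longrightarrow> 0 < g u u"
  shows "(g u v)\<^sup>2 \<le> g u u * g v v"
proof (cases "v = 0")
  case True
  have "g u v = 0" "g v v = 0"
    unfolding True using linear_0[OF lin] sym by metis+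
  then show ?thesis by simp
next
  case False
  define s where "s = g u v / g v v"
  have nonneg: "0 \<le> g w w" for w
    using pos[of w] linear_0[OF lin, of 0] by (cases "w = 0") auto
  have l1: "g (x - s *\<^sub>R y) z = g x z - s * g y z" for x y z
    using linear_diff[OF lin[of z]] linear_cmul[OF lin[of z]] by simp
  have l2: "g z (x - s *\<^sub>R y) = g z x - s * g z y" for x y z
    unfolding sym[of z] by (rule l1)
  have "0 \<le> g (u - s *\<^sub>R v) (u - s *\<^sub>R v)" by (rule nonneg)
  also have "\<dots> = g u u - s * g u v - s * (g u v - s * g v v)"
    unfolding l1 l2 sym[of v u] by simp
  also have "\<dots> = g u u - (g u v)\<^sup>2 / g v v"
    using pos[OF False] by (simp add: s_def power2_eq_square)
  finally show ?thesis using pos[OF False] by (simp add: field_simps)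
qed

text \<open>The bound on \<open>s\<^sup>2\<close> puts the quotient in the interval from -1 to 1,
  where \<open>arccos\<close> is decreasing. If \<open>a\<close> or \<open>b\<close> is 0, then
  \<open>s\<close> is 0 and the quotient is 0 by the convention for division.\<close>

lemma arccos_quotient_cases:
  fixes s a b :: real
  assumes "s\<^sup>2 \<le> a * b" "0 \<le> a" "0 \<le> b"
  defines "\<theta> \<equiv> arccos (s / (sqrt a * sqrt b))"
  shows "(\<theta> < pi / 2 \<longleftrightarrow> 0 < s) \<and> (\<theta> = pi / 2 \<longleftrightarrow> s = 0) \<and> (pi / 2 < \<theta> \<longleftrightarrow> s < 0)"
proof (cases "s = 0")
  case True
  then show ?thesis by (simp add: \<theta>_def)
next
  case False
  then have "0 < a * b" using assms(1) by (smt (verit) zero_less_power2)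
  then have d: "0 < sqrt a * sqrt b" by (simp flip: real_sqrt_mult)
  have "\<bar>s\<bar> \<le> sqrt a * sqrt b"
    using real_sqrt_le_mono[OF assms(1)] by (simp add: real_sqrt_mult)
  with d have r: "-1 \<le> s / (sqrt a * sqrt b)" "s / (sqrt a * sqrt b) \<le> 1"
    by (auto simp: field_simps)
  have "\<theta> < pi / 2 \<longleftrightarrow> 0 < s / (sqrt a * sqrt b)" "pi / 2 < \<theta> \<longleftrightarrow> s / (sqrt a * sqrt b) < 0"
    unfolding \<theta>_def using arccos_less_mono[of "s / (sqrt a * sqrt b)" 0]
      arccos_less_mono[of 0 "s / (sqrt a * sqrt b)"] r by (auto simp: abs_le_iff)
  with d have "(\<theta> < pi / 2 \<longleftrightarrow> 0 < s)" "(pi / 2 < \<theta> \<longleftrightarrow> s < 0)"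
    by (auto simp: zero_less_divide_iff divide_less_0_iff)
  with False show ?thesis by argo
qed

lemma invertible_if_definite:
  fixes M :: "real ^ 'm ^ 'm"
  assumes "\<And>v. v \<noteq> 0 \<Longrightarrow> v \<bullet> (M *v v) \<noteq> 0"
  shows "invertible M"
proof -
  have "x = 0" if "M *v x = 0" for x using assms[of x] that by auto
  then show ?thesis by (simp add: invertible_left_inverse matrix_left_invertible_ker)
qed

section \<open>Tangent hyperplanes of an exponentially concave function\<close>

lemma subspace_tangent_space: "subspace tangent_space"
  by (simp add: subspace_def tangent_space_def sum.distrib flip: sum_distrib_left)

lemma diff_tangent_space:
  "p \<in> unit_simplex \<Longrightarrow> q \<in> unit_simplex \<Longrightarrow> q - p \<in> tangent_space"
  by (simp add: unit_simplex_def tangent_space_def sum_subtractf)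

lemma eventually_line_in_simplex:
  assumes "p \<in> unit_simplex" "v \<in> tangent_space"
  shows "eventually (\<lambda>t. p + t *\<^sub>R v \<in> unit_simplex) (nhds 0)"
proof -
  have eq: "{x :: real ^ 'n. \<forall>i. 0 < x $ i} = (\<Inter>i\<in>UNIV. {x. 0 < x $ i})" by auto
  have "open {x :: real ^ 'n. \<forall>i. 0 < x $ i}"
    unfolding eq by (intro open_INT ballI open_Collect_less continuous_intros) auto
  moreover have "p \<in> {x. \<forall>i. 0 < x $ i}" using assms(1) by (simp add: unit_simplex_def)
  ultimately have "eventually (\<lambda>t. p + t *\<^sub>R v \<in> {x. \<forall>i. 0 < x $ i}) (nhds 0)"
    by (rule eventually_line_in_open)
  then show ?thesis
    by (rule eventually_mono)
       (use assms in \<open>auto simp: unit_simplex_def tangent_space_def sum.distrib simp flip: sum_distrib_left\<close>)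
qed

text \<open>The coordinates are the values of the tangent hyperplane to the graph of \<open>exp
  \<circ> \<phi>\<close> at the vertices of the simplex. Vertices are used because \<open>axis s 1 -
  p\<close> is tangent, whereas the partial derivatives of \<open>\<phi>\<close> depend on its
  values off the simplex.\<close>

definition support_vector :: "(real ^ 'n \<Rightarrow> real) \<Rightarrow> real ^ 'n \<Rightarrow> real ^ 'n" where
  "support_vector \<phi> p = (\<chi> s. exp (\<phi> p) * (1 + dir_deriv \<phi> p (axis s 1 - p)))"

text \<open>A smooth function on the simplex is differentiated in tangent directions through a local
  extension, as lines in tangent directions stay in the simplex for a short time.\<close>

lemma smooth_on_simplex_extension:
  fixes \<phi> :: "real ^ 'n \<Rightarrow> real"
  assumes "smooth_on unit_simplex \<phi>" "p \<in> unit_simplex"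
  obtains W F where "open W" "p \<in> W" "\<And>k. Ck_on k W F" "\<And>y. y \<in> W \<inter> unit_simplex \<Longrightarrow> F y = \<phi> y"
    "\<And>y. y \<in> W \<Longrightarrow> (F has_derivative frechet_derivative F (at y)) (at y)"
    "\<And>y v. y \<in> W \<inter> unit_simplex \<Longrightarrow> v \<in> tangent_space \<Longrightarrow>
        dir_deriv \<phi> y v = frechet_derivative F (at y) v"
proof -
  from assms obtain W F where W: "open W" "p \<in> W" "\<And>k. Ck_on k W F" "\<And>y. y \<in> W \<inter> unit_simplex \<Longrightarrow> F y = \<phi> y"
    unfolding smooth_on_def by meson
  have d: "(F has_derivative frechet_derivative F (at y)) (at y)" if "y \<in> W" for y
    using Ck_on_SucD[OF W(3)] that by blast
  have "dir_deriv \<phi> y v = frechet_derivative F (at y) v" if y: "y \<in> W \<inter> unit_simplex" "v \<in> tangent_space" for y v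
  proof -
    have "eventually (\<lambda>t. y + t *\<^sub>R v \<in> W \<and> y + t *\<^sub>R v \<in> unit_simplex) (nhds 0)"
      using y W by (intro eventually_conj eventually_line_in_open eventually_line_in_simplex) auto
    then have "dir_deriv \<phi> y v = dir_deriv F y v"
      by (intro dir_deriv_cong) (auto elim!: eventually_mono simp: W(4))
    then show ?thesis using dir_deriv_eqI[OF d] y by simp
  qed
  with W d that show thesis by blast
qed

lemma axis_minus_in_tangent_space: "axis s 1 - p \<in> tangent_space" if "p \<in> unit_simplex" for p :: "real ^ 'n"
  using that by (simp add: unit_simplex_def tangent_space_def sum_subtractf axis_def)

context
  fixes \<phi> :: "real ^ 'n \<Rightarrow> real"
  assumes smooth: "smooth_on unit_simplex \<phi>"
begin

text \<open>The first part is the value at \<open>z\<close> of the tangent hyperplane to the graph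
  of \<open>exp \<circ> \<phi>\<close> at \<open>p\<close>, the second part is its slope. Both hold
  because the directional derivative is linear in tangent directions, which a local smooth extension
  of \<open>\<phi>\<close> shows.\<close>

lemma support_vector_inner:
  assumes p: "p \<in> unit_simplex"
  shows "(\<Sum>i\<in>UNIV. z $ i) = 1 \<Longrightarrow>
           support_vector \<phi> p \<bullet> z = exp (\<phi> p) * (1 + dir_deriv \<phi> p (z - p))" (is "?s \<Longrightarrow> ?A")
    and "z \<in> tangent_space \<Longrightarrow> support_vector \<phi> p \<bullet> z = exp (\<phi> p) * dir_deriv \<phi> p z" (is "?t \<Longrightarrow> ?B")
proof -
  obtain W F where W: "p \<in> W" "\<And>y. y \<in> W \<Longrightarrow> (F has_derivative frechet_derivative F (at y)) (at y)"
    "\<And>y v. y \<in> W \<inter> unit_simplex \<Longrightarrow> v \<in> tangent_space \<Longrightarrow>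
        dir_deriv \<phi> y v = frechet_derivative F (at y) v"
    using smooth_on_simplex_extension[OF smooth p] by metis
  define f where "f = frechet_derivative F (at p)"
  have lin: "linear f" using has_derivative_linear[OF W(2)[OF W(1)]] by (simp add: f_def)
  have dd: "v \<in> tangent_space \<Longrightarrow> dir_deriv \<phi> p v = f v" for v
    using W(3)[of p v] W(1) p by (simp add: f_def)
  have "support_vector \<phi> p \<bullet> z = (\<Sum>s\<in>UNIV. exp (\<phi> p) * (1 + f (axis s 1 - p)) * z $ s)"
    by (simp add: inner_vec_def support_vector_def dd axis_minus_in_tangent_space[OF p])
  also have "\<dots> = exp (\<phi> p) * (\<Sum>s\<in>UNIV. (1 - f p) * z $ s + z $ s *\<^sub>R f (axis s 1))"
    by (simp add: linear_diff[OF lin] sum_distrib_left algebra_simps)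
  also have "\<dots> = exp (\<phi> p) * ((1 - f p) * (\<Sum>s\<in>UNIV. z $ s) + f z)"
    unfolding linear_axis_expansion[OF lin, of z] by (simp only: sum.distrib sum_distrib_left)
  finally have *: "support_vector \<phi> p \<bullet> z = exp (\<phi> p) * ((1 - f p) * (\<Sum>s\<in>UNIV. z $ s) + f z)" .
  show "?A" if ?s
  proof -
    have "z - p \<in> tangent_space"
      using that p by (simp add: unit_simplex_def tangent_space_def sum_subtractf)
    with * that show ?thesis by (simp add: dd linear_diff[OF lin] algebra_simps)
  qed
  show "?B" if ?t using * that dd[OF that] by (simp add: tangent_space_def)
qed

lemma support_vector_self: "p \<in> unit_simplex \<Longrightarrow> support_vector \<phi> p \<bullet> p = exp (\<phi> p)"
  using support_vector_inner(1)[of p p] by (simp add: unit_simplex_def dir_deriv_def)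

lemma exp_has_derivative_along_line:
  assumes p: "p \<in> unit_simplex" and v: "v \<in> tangent_space"
  shows "((\<lambda>t. exp (\<phi> (p + t *\<^sub>R v))) has_real_derivative support_vector \<phi> p \<bullet> v) (at 0)"
proof -
  obtain W F where W: "open W" "p \<in> W" "\<And>y. y \<in> W \<inter> unit_simplex \<Longrightarrow> F y = \<phi> y"
    "\<And>y. y \<in> W \<Longrightarrow> (F has_derivative frechet_derivative F (at y)) (at y)"
    "\<And>y v. y \<in> W \<inter> unit_simplex \<Longrightarrow> v \<in> tangent_space \<Longrightarrow>
        dir_deriv \<phi> y v = frechet_derivative F (at y) v"
    using smooth_on_simplex_extension[OF smooth p] by metis
  have "((\<lambda>t. F (p + t *\<^sub>R v)) has_real_derivative frechet_derivative F (at p) v) (at 0)"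
    unfolding has_real_derivative_iff_has_vector_derivative
    using W(2,4) by (intro has_vector_derivative_along_line) simp
  from DERIV_chain2[OF DERIV_exp this]
  have "((\<lambda>t. exp (F (p + t *\<^sub>R v))) has_real_derivative exp (F p) * frechet_derivative F (at p) v) (at 0)"
    by simp
  moreover have "exp (F p) * frechet_derivative F (at p) v = support_vector \<phi> p \<bullet> v"
    using W p v by (simp add: support_vector_inner(2))
  moreover have "eventually (\<lambda>t. exp (F (p + t *\<^sub>R v)) = exp (\<phi> (p + t *\<^sub>R v))) (nhds 0)"
  proof -
    have "eventually (\<lambda>t. p + t *\<^sub>R v \<in> W \<and> p + t *\<^sub>R v \<in> unit_simplex) (nhds 0)"
      using p v W by (intro eventually_conj eventually_line_in_open eventually_line_in_simplex) auto
    then show ?thesis by (rule eventually_mono) (simp add: W(3))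
  qed
  ultimately show ?thesis by (simp add: DERIV_cong_ev)
qed

text \<open>The graph of a concave function lies below its tangent hyperplanes; this is reduced to
  the one-dimensional case on the line through \<open>p\<close> and \<open>q\<close>.\<close>

lemma support_vector_above:
  assumes conc: "exponentially_concave \<phi>" and p: "p \<in> unit_simplex" and q: "q \<in> unit_simplex"
  shows "exp (\<phi> q) \<le> support_vector \<phi> p \<bullet> q"
proof -
  define v where "v = q - p"
  have v: "v \<in> tangent_space" unfolding v_def by (rule diff_tangent_space[OF p q])
  define A where "A = {t. p + t *\<^sub>R v \<in> unit_simplex}"
  have cs: "convex_on unit_simplex (\<lambda>p. - exp (\<phi> p))" "convex (unit_simplex :: (real ^ 'n) set)"
    using conc by (auto simp: exponentially_concave_def concave_on_def convex_on_imp_convex)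
  have line: "p + ((1 - s) * t + s * t') *\<^sub>R v = (1 - s) *\<^sub>R (p + t *\<^sub>R v) + s *\<^sub>R (p + t' *\<^sub>R v)" for s t t'
    by (simp add: algebra_simps)
  have convA: "convex A"
    unfolding convex_alt A_def using cs(2)[unfolded convex_alt] by (auto simp: line)
  have "convex_on A (\<lambda>t. - exp (\<phi> (p + t *\<^sub>R v)))"
    by (rule convex_onI[OF _ convA])
       (use convex_onD[OF cs(1)] in \<open>auto simp: A_def line\<close>)
  moreover have "0 \<in> interior A"
    using eventually_line_in_simplex[OF p v] by (simp add: A_def eventually_nhds interior_def) blast
  moreover have "1 \<in> A" using q by (simp add: A_def v_def)
  moreover have "((\<lambda>t. - exp (\<phi> (p + t *\<^sub>R v))) has_real_derivative - (support_vector \<phi> p \<bullet> v)) (at 0 within A)"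
    by (intro DERIV_minus has_field_derivative_at_within[OF exp_has_derivative_along_line[OF p v]])
  ultimately have "- exp (\<phi> (p + 1 *\<^sub>R v)) - - exp (\<phi> (p + 0 *\<^sub>R v)) \<ge> - (support_vector \<phi> p \<bullet> v) * (1 - 0)"
    by (rule convex_on_imp_above_tangent[OF _ convex_connected[OF convA]])
  then show ?thesis
    using support_vector_self[OF p] by (simp add: v_def inner_diff_right)
qed

lemma smooth_on_support_vector: "smooth_on unit_simplex (support_vector \<phi>)"
  unfolding smooth_on_def
proof
  fix p :: "real ^ 'n" assume p: "p \<in> unit_simplex"
  obtain W F where W: "open W" "p \<in> W" "\<And>k. Ck_on k W F" "\<And>y. y \<in> W \<inter> unit_simplex \<Longrightarrow> F y = \<phi> y"
    "\<And>y. y \<in> W \<Longrightarrow> (F has_derivative frechet_derivative F (at y)) (at y)"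
    "\<And>y v. y \<in> W \<inter> unit_simplex \<Longrightarrow> v \<in> tangent_space \<Longrightarrow>
        dir_deriv \<phi> y v = frechet_derivative F (at y) v"
    using smooth_on_simplex_extension[OF smooth p] by metis
  \<comment> \<open>the formula for the support vector with the linear map \<open>frechet_derivative F (at y)\<close> expanded in coordinates,
    since only its values at fixed vectors are known to be \<open>C\<^sup>k\<close> in \<open>y\<close>\<close>
  define H where "H = (\<lambda>y. \<Sum>s\<in>UNIV. (exp (F y) * (1 + frechet_derivative F (at y) (axis s 1) +
     (\<Sum>i\<in>UNIV. (- (y $ i)) * frechet_derivative F (at y) (axis i 1)))) *\<^sub>R (axis s 1 :: real ^ 'n))"
  have F': "Ck_on k W (\<lambda>y. frechet_derivative F (at y) v)" for k v
    using W(3)[of "Suc k"] by simp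
  have "Ck_on k W H" for k
    unfolding H_def
    by (intro Ck_on_sum Ck_on_bilinear[OF bounded_bilinear_scaleR] Ck_on_bilinear[OF bounded_bilinear_mult]
        Ck_on_add Ck_on_const F' W Ck_on_compose[OF W(1) _ W(3) Ck_on_exp]
        Ck_on_linear bounded_linear_minus bounded_linear_vec_nth) auto
  moreover have "H y = support_vector \<phi> y" if y: "y \<in> W \<inter> unit_simplex" for y
  proof -
    have lin: "linear (frechet_derivative F (at y))" using has_derivative_linear W(5) y by blast
    have eq: "1 + frechet_derivative F (at y) (axis s 1) +
     (\<Sum>i\<in>UNIV. (- (y $ i)) * frechet_derivative F (at y) (axis i 1)) = 1 + dir_deriv \<phi> y (axis s 1 - y)" for s
      using W(6)[OF y axis_minus_in_tangent_space] y linear_axis_expansion[OF lin, of y]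
      by (simp add: linear_diff[OF lin] sum_negf)
    show ?thesis unfolding H_def eq using W(4)[OF y]
      by (simp add: vec_eq_iff support_vector_def axis_def if_distrib cong: if_cong)
  qed
  ultimately show "\<exists>W F. open W \<and> p \<in> W \<and> (\<forall>k. Ck_on k W F) \<and> (\<forall>y\<in>W \<inter> unit_simplex. F y = support_vector \<phi> y)"
    using W by blast
qed

text \<open>This is the reason for the support vector: \<open>T(q | p)\<close> is the logarithm of a
  pairing that is linear in the data of \<open>p\<close> and in \<open>q\<close>, up to a function
  of \<open>q\<close> alone.\<close>

lemma L_divergence_eq:
  assumes "p \<in> unit_simplex" "q \<in> unit_simplex" "0 < support_vector \<phi> p \<bullet> q"
  shows "L_divergence \<phi> q p = ln (support_vector \<phi> p \<bullet> q) - \<phi> q"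
proof -
  have "support_vector \<phi> p \<bullet> q = exp (\<phi> p) * (1 + dir_deriv \<phi> p (q - p))"
    using assms by (intro support_vector_inner) (auto simp: unit_simplex_def)
  moreover from this assms(3) have "0 < 1 + dir_deriv \<phi> p (q - p)"
    by (simp add: zero_less_mult_iff)
  ultimately show ?thesis by (simp add: L_divergence_def ln_mult)
qed

end

section \<open>The metric in coordinates\<close>

locale exp_concave_geometry =
  fixes \<phi> :: "real ^ 'n \<Rightarrow> real" and \<xi> :: "real ^ 'n \<Rightarrow> real ^ 'm"
  assumes smooth: "smooth_on unit_simplex \<phi>"
    and conc: "exponentially_concave \<phi>"
    and neg_def: "\<And>x v. x \<in> unit_simplex \<Longrightarrow> v \<in> tangent_space \<Longrightarrow> v \<noteq> 0 \<Longrightarrow>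
           hess (\<lambda>y. exp (\<phi> y)) x v v < 0"
    and coords: "coordinate_system \<xi>"
begin

text \<open>\<open>U\<close> and \<open>\<psi>\<close> are the domain of the coordinate vectors and
  the inverse of the chart. \<open>B\<close> is the support vector as a function of the coordinates
  of its base point, so that the divergence is \<open>ln (B b \<bullet> \<psi> a) - \<phi> (\<psi>
  a)\<close>. A prime denotes the derivative, and \<open>d\<xi> p\<close> is the derivative of the
  chart on tangent vectors at \<open>p\<close>.\<close>

definition U where "U = \<xi> ` unit_simplex"
definition \<psi> where "\<psi> = inv_into unit_simplex \<xi>"
definition B where "B b = support_vector \<phi> (\<psi> b)"
definition \<psi>' where "\<psi>' a = frechet_derivative \<psi> (at a)"
definition B' where "B' a = frechet_derivative B (at a)"
definition d\<xi> where "d\<xi> p w = (\<chi> i. dir_deriv (\<lambda>y. \<xi> y $ i) p w)"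

lemma open_U: "open U" and smooth_\<xi>: "smooth_on unit_simplex \<xi>" and smooth_\<psi>: "smooth_on U \<psi>"
  using coords by (auto simp: coordinate_system_def U_def \<psi>_def)

lemma \<psi>_in [simp]: "a \<in> U \<Longrightarrow> \<psi> a \<in> unit_simplex"
  by (auto simp: U_def \<psi>_def inv_into_into)
lemma \<xi>_in [simp]: "p \<in> unit_simplex \<Longrightarrow> \<xi> p \<in> U"
  by (simp add: U_def)
lemma \<xi>_\<psi> [simp]: "a \<in> U \<Longrightarrow> \<xi> (\<psi> a) = a"
  by (simp add: U_def \<psi>_def f_inv_into_f)
lemma \<psi>_\<xi> [simp]: "p \<in> unit_simplex \<Longrightarrow> \<psi> (\<xi> p) = p"
  using coords by (simp add: \<psi>_def coordinate_system_def)

lemma Ck_\<psi>: "Ck_on k U \<psi>"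
  by (rule smooth_on_imp_Ck_on[OF open_U smooth_\<psi>])

lemma smooth_B: "smooth_on U B"
  unfolding B_def by (rule smooth_on_compose[OF smooth_\<psi> smooth_on_support_vector[OF smooth]]) auto

lemma Ck_B: "Ck_on k U B"
  by (rule smooth_on_imp_Ck_on[OF open_U smooth_B])

lemma has_derivative_\<psi>: "a \<in> U \<Longrightarrow> (\<psi> has_derivative \<psi>' a) (at a)"
  unfolding \<psi>'_def by (rule Ck_on_SucD[OF Ck_\<psi>])

lemma has_derivative_B: "a \<in> U \<Longrightarrow> (B has_derivative B' a) (at a)"
  unfolding B'_def by (rule Ck_on_SucD[OF Ck_B])

lemma linear_\<psi>': "a \<in> U \<Longrightarrow> linear (\<psi>' a)" and linear_B': "a \<in> U \<Longrightarrow> linear (B' a)"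
  using has_derivative_\<psi> has_derivative_B has_derivative_linear by blast+

lemma B_pos: "a \<in> U \<Longrightarrow> b \<in> U \<Longrightarrow> 0 < B b \<bullet> \<psi> a"
  unfolding B_def using support_vector_above[OF smooth conc, of "\<psi> b" "\<psi> a"]
  by (meson \<psi>_in exp_gt_zero less_le_trans)

lemma B_\<psi>: "a \<in> U \<Longrightarrow> B a \<bullet> \<psi> a = exp (\<phi> (\<psi> a))"
  unfolding B_def by (intro support_vector_self smooth \<psi>_in)

lemma \<psi>'_tangent: "\<psi>' a v \<in> tangent_space" if a: "a \<in> U"
proof -
  have "((\<lambda>b. \<Sum>i\<in>UNIV. \<psi> b $ i) has_derivative (\<lambda>v. \<Sum>i\<in>UNIV. \<psi>' a v $ i)) (at a)"
    by (intro has_derivative_sum bounded_linear.has_derivative[OF bounded_linear_vec_nth] has_derivative_\<psi> a)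
  moreover have "((\<lambda>b. \<Sum>i\<in>UNIV. \<psi> b $ i) has_derivative (\<lambda>v. 0)) (at a)"
    by (rule has_derivative_transform_within_open[OF has_derivative_const[of 1] open_U a])
       (use \<psi>_in in \<open>auto simp: unit_simplex_def\<close>)
  ultimately have "(\<lambda>v. \<Sum>i\<in>UNIV. \<psi>' a v $ i) = (\<lambda>v. 0)" by (rule has_derivative_unique)
  then show ?thesis by (auto simp: tangent_space_def dest: fun_cong)
qed

lemma exp_\<phi>_\<psi>_has_derivative:
  assumes a: "a \<in> U"
  shows "((\<lambda>b. exp (\<phi> (\<psi> b))) has_derivative (\<lambda>v. B a \<bullet> \<psi>' a v)) (at a)"
proof -
  obtain W F where W: "open W" "\<psi> a \<in> W" "\<And>y. y \<in> W \<inter> unit_simplex \<Longrightarrow> F y = \<phi> y"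
    "\<And>y. y \<in> W \<Longrightarrow> (F has_derivative frechet_derivative F (at y)) (at y)"
    "\<And>y v. y \<in> W \<inter> unit_simplex \<Longrightarrow> v \<in> tangent_space \<Longrightarrow>
        dir_deriv \<phi> y v = frechet_derivative F (at y) v"
    using smooth_on_simplex_extension[OF smooth \<psi>_in[OF a]] by metis
  have "continuous_on U \<psi>" using Ck_\<psi>[of 0] by simp
  then have o: "open (\<psi> -` W \<inter> U)" using open_U W(1) continuous_on_open_vimage by blast
  have "((\<lambda>b. exp (F (\<psi> b))) has_derivative
      (\<lambda>v. exp (F (\<psi> a)) * frechet_derivative F (at (\<psi> a)) (\<psi>' a v))) (at a)"
    using has_derivative_compose[OF has_derivative_\<psi>[OF a] W(4)[OF W(2)]]
    by (auto intro!: derivative_eq_intros)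
  also have "(\<lambda>v. exp (F (\<psi> a)) * frechet_derivative F (at (\<psi> a)) (\<psi>' a v)) = (\<lambda>v. B a \<bullet> \<psi>' a v)"
    using W(2,3,5) a by (auto simp: B_def support_vector_inner(2)[OF smooth] \<psi>'_tangent)
  finally show ?thesis
    by (rule has_derivative_transform_within_open[OF _ o]) (use W a in auto)
qed

text \<open>Differentiate \<open>B b \<bullet> \<psi> b = exp (\<phi> (\<psi> b))\<close>: the
  derivative of the right-hand side is already \<open>B a \<bullet> \<psi>' a v\<close>.
  Geometrically, an infinitesimal move of the tangent hyperplane does not change its height above
  the base point to first order.\<close>

lemma B'_\<psi>: assumes a: "a \<in> U" shows "B' a v \<bullet> \<psi> a = 0"
proof -
  have "((\<lambda>b. B b \<bullet> \<psi> b) has_derivative (\<lambda>v. B a \<bullet> \<psi>' a v + B' a v \<bullet> \<psi> a)) (at a)"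
    by (intro has_derivative_inner has_derivative_\<psi> has_derivative_B a)
  moreover have "((\<lambda>b. B b \<bullet> \<psi> b) has_derivative (\<lambda>v. B a \<bullet> \<psi>' a v)) (at a)"
    by (rule has_derivative_transform_within_open[OF exp_\<phi>_\<psi>_has_derivative[OF a] open_U a])
       (simp add: B_\<psi>)
  ultimately have "(\<lambda>v. B a \<bullet> \<psi>' a v + B' a v \<bullet> \<psi> a) = (\<lambda>v. B a \<bullet> \<psi>' a v)"
    by (rule has_derivative_unique)
  then show ?thesis by (auto dest: fun_cong[where x = v])
qed

text \<open>Differentiating \<open>B' b v \<bullet> \<psi> b = 0\<close> in the direction
  \<open>u\<close> gives \<open>B' a v \<bullet> \<psi>' a u = - B'' a u v \<bullet> \<psi>
  a\<close>, and second derivatives are symmetric.\<close>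

lemma B'_\<psi>'_symmetric:
  assumes a: "a \<in> U" shows "B' a v \<bullet> \<psi>' a u = B' a u \<bullet> \<psi>' a v"
proof -
  \<comment> \<open>\<open>\<psi> a\<close> is held fixed, so the second derivatives of \<open>h\<close> at \<open>a\<close> are \<open>B'' a u v \<bullet> \<psi> a\<close>\<close>
  define h where "h b = B b \<bullet> \<psi> a" for b
  have h: "Ck_on 2 U h" unfolding h_def
    by (intro Ck_on_bilinear[OF bounded_bilinear_inner] Ck_on_const Ck_B open_U)
  have h': "frechet_derivative h (at b) v = B' b v \<bullet> \<psi> a" if "b \<in> U" for b v
  proof -
    have "(h has_derivative (\<lambda>v. B' b v \<bullet> \<psi> a)) (at b)" unfolding h_def
      using has_derivative_B[OF that] by (auto intro!: derivative_eq_intros)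
    from frechet_derivative_at[OF this] show ?thesis by metis
  qed
  have key: "frechet_derivative (\<lambda>b. frechet_derivative h (at b) v) (at a) u = - (B' a v \<bullet> \<psi>' a u)" for u v
  proof -
    have "Ck_on (Suc 0) U (\<lambda>b. B' b v)" using Ck_B[of "Suc (Suc 0)"] by (simp add: B'_def)
    then obtain D where D: "((\<lambda>b. B' b v) has_derivative D) (at a)"
      using Ck_on_SucD a by blast
    then have "((\<lambda>b. B' b v \<bullet> \<psi> b) has_derivative (\<lambda>u. B' a v \<bullet> \<psi>' a u + D u \<bullet> \<psi> a)) (at a)"
      by (intro has_derivative_inner has_derivative_\<psi> a)
    moreover have "((\<lambda>b. B' b v \<bullet> \<psi> b) has_derivative (\<lambda>u. 0)) (at a)"
      by (rule has_derivative_transform_within_open[OF has_derivative_const[of 0] open_U a])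
         (simp add: B'_\<psi>)
    ultimately have "(\<lambda>u. B' a v \<bullet> \<psi>' a u + D u \<bullet> \<psi> a) = (\<lambda>u. 0)"
      by (rule has_derivative_unique)
    then have "D u \<bullet> \<psi> a = - (B' a v \<bullet> \<psi>' a u)" by (simp add: fun_eq_iff add_eq_0_iff)
    moreover have "((\<lambda>b. frechet_derivative h (at b) v) has_derivative (\<lambda>u. D u \<bullet> \<psi> a)) (at a)"
      by (rule has_derivative_transform_within_open[OF _ open_U a])
         (auto intro!: derivative_eq_intros D simp: h')
    from frechet_derivative_at[OF this]
    have "frechet_derivative (\<lambda>b. frechet_derivative h (at b) v) (at a) u = D u \<bullet> \<psi> a" by metis
    ultimately show ?thesis by simp
  qed
  show ?thesis
    using second_derivative_symmetric[OF open_U a h, of u v] by (simp add: key)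
qed

lemma coordinates_extension:
  assumes p: "p \<in> unit_simplex"
  obtains W X where "open W" "p \<in> W" "\<And>y. y \<in> W \<inter> unit_simplex \<Longrightarrow> X y = \<xi> y"
    "(X has_derivative frechet_derivative X (at p)) (at p)"
    "\<And>w. w \<in> tangent_space \<Longrightarrow> d\<xi> p w = frechet_derivative X (at p) w"
proof -
  from smooth_\<xi> p obtain W X where W: "open W" "p \<in> W" "\<And>k. Ck_on k W X" "\<And>y. y \<in> W \<inter> unit_simplex \<Longrightarrow> X y = \<xi> y"
    unfolding smooth_on_def by meson
  have d: "(X has_derivative frechet_derivative X (at p)) (at p)"
    using Ck_on_SucD[OF W(3)] W(2) by blast
  have "d\<xi> p w = frechet_derivative X (at p) w" if w: "w \<in> tangent_space" for w
  proof -
    have "eventually (\<lambda>t. p + t *\<^sub>R w \<in> W \<and> p + t *\<^sub>R w \<in> unit_simplex) (nhds 0)"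
      using p w W by (intro eventually_conj eventually_line_in_open eventually_line_in_simplex) auto
    then have "dir_deriv (\<lambda>y. \<xi> y $ i) p w = dir_deriv (\<lambda>y. X y $ i) p w" for i
      by (intro dir_deriv_cong) (auto elim!: eventually_mono simp: W(4))
    also have "dir_deriv (\<lambda>y. X y $ i) p w = frechet_derivative X (at p) w $ i" for i
      by (intro dir_deriv_eqI bounded_linear.has_derivative[OF bounded_linear_vec_nth] d)
    finally show ?thesis by (simp add: d\<xi>_def vec_eq_iff)
  qed
  with W d that show thesis by blast
qed

lemma \<xi>_line:
  assumes p: "p \<in> unit_simplex" and w: "w \<in> tangent_space"
  shows "((\<lambda>t. \<xi> (p + t *\<^sub>R w)) has_vector_derivative d\<xi> p w) (at 0)"
proof -
  obtain W X where W: "open W" "p \<in> W" "\<And>y. y \<in> W \<inter> unit_simplex \<Longrightarrow> X y = \<xi> y"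
    "(X has_derivative frechet_derivative X (at p)) (at p)"
    "\<And>w. w \<in> tangent_space \<Longrightarrow> d\<xi> p w = frechet_derivative X (at p) w"
    using coordinates_extension[OF p] by metis
  have "((\<lambda>t. X (p + t *\<^sub>R w)) has_vector_derivative d\<xi> p w) (at 0)"
    unfolding W(5)[OF w] by (rule has_vector_derivative_along_line) (simp add: W)
  moreover have "eventually (\<lambda>t. X (p + t *\<^sub>R w) = \<xi> (p + t *\<^sub>R w)) (nhds 0)"
  proof -
    have "eventually (\<lambda>t. p + t *\<^sub>R w \<in> W \<and> p + t *\<^sub>R w \<in> unit_simplex) (nhds 0)"
      using p w W by (intro eventually_conj eventually_line_in_open eventually_line_in_simplex) auto
    then show ?thesis by (rule eventually_mono) (simp add: W(3))
  qed
  then obtain S where "open S" "0 \<in> S" "\<And>t. t \<in> S \<Longrightarrow> X (p + t *\<^sub>R w) = \<xi> (p + t *\<^sub>R w)"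
    unfolding eventually_nhds by auto
  ultimately show ?thesis by (rule has_vector_derivative_transform_within_open)
qed

lemma \<psi>'_d\<xi>:
  assumes p: "p \<in> unit_simplex" and w: "w \<in> tangent_space"
  shows "\<psi>' (\<xi> p) (d\<xi> p w) = w"
proof -
  obtain S where S: "open S" "0 \<in> S" "\<And>t. t \<in> S \<Longrightarrow> p + t *\<^sub>R w \<in> unit_simplex"
    using eventually_line_in_simplex[OF p w] unfolding eventually_nhds by auto
  have "((\<psi> \<circ> (\<lambda>t. \<xi> (p + t *\<^sub>R w))) has_vector_derivative \<psi>' (\<xi> p) (d\<xi> p w)) (at 0)"
    using vector_derivative_diff_chain_within[OF \<xi>_line[OF p w], of \<psi> "\<psi>' (\<xi> p)"]
      has_derivative_at_withinI[OF has_derivative_\<psi>[OF \<xi>_in[OF p]]] by simp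
  then have "((\<lambda>t. p + t *\<^sub>R w) has_vector_derivative \<psi>' (\<xi> p) (d\<xi> p w)) (at 0)"
    by (rule has_vector_derivative_transform_within_open[OF _ S(1,2)]) (use S in auto)
  moreover have "((\<lambda>t. p + t *\<^sub>R w) has_vector_derivative w) (at 0)"
    by (auto intro!: derivative_eq_intros)
  ultimately show ?thesis by (metis vector_derivative_at)
qed

lemma d\<xi>_\<psi>':
  assumes a: "a \<in> U"
  shows "d\<xi> (\<psi> a) (\<psi>' a v) = v"
proof -
  obtain W X where W: "open W" "\<psi> a \<in> W" "\<And>y. y \<in> W \<inter> unit_simplex \<Longrightarrow> X y = \<xi> y"
    "(X has_derivative frechet_derivative X (at (\<psi> a))) (at (\<psi> a))"
    "\<And>w. w \<in> tangent_space \<Longrightarrow> d\<xi> (\<psi> a) w = frechet_derivative X (at (\<psi> a)) w"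
    using coordinates_extension[OF \<psi>_in[OF a]] by metis
  have "continuous_on U \<psi>" using Ck_\<psi>[of 0] by simp
  then have o: "open (\<psi> -` W \<inter> U)" using open_U W(1) continuous_on_open_vimage by blast
  have "((\<lambda>b. X (\<psi> b)) has_derivative (\<lambda>v. frechet_derivative X (at (\<psi> a)) (\<psi>' a v))) (at a)"
    by (rule has_derivative_compose[OF has_derivative_\<psi>[OF a] W(4)])
  then have "((\<lambda>b. b) has_derivative (\<lambda>v. frechet_derivative X (at (\<psi> a)) (\<psi>' a v))) (at a)"
    by (rule has_derivative_transform_within_open[OF _ o]) (use W a in auto)
  then have "(\<lambda>v. frechet_derivative X (at (\<psi> a)) (\<psi>' a v)) = (\<lambda>v. v)"
    by (rule has_derivative_unique) (rule has_derivative_ident)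
  then show ?thesis using W(5)[OF \<psi>'_tangent[OF a]] by (auto dest: fun_cong)
qed

text \<open>For the tangent vector \<open>w = \<psi>' a v\<close>, the expression is the Hessian of
  \<open>exp \<circ> \<phi>\<close> at \<open>(w, w)\<close>: along a line in direction
  \<open>w\<close> the derivative of \<open>exp \<circ> \<phi>\<close> in direction \<open>w\<close>
  is \<open>B \<bullet> w\<close>, with \<open>w\<close> constant.\<close>

lemma B'_\<psi>'_negative:
  assumes a: "a \<in> U" and v: "v \<noteq> 0"
  shows "B' a v \<bullet> \<psi>' a v < 0"
proof -
  define w where "w = \<psi>' a v"
  define p where "p = \<psi> a"
  have p: "p \<in> unit_simplex" and w: "w \<in> tangent_space" and ap: "a = \<xi> p"
    using a \<psi>'_tangent by (auto simp: p_def w_def)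
  have dw: "d\<xi> p w = v" unfolding p_def w_def by (rule d\<xi>_\<psi>'[OF a])
  have "w \<noteq> 0"
    using v dw \<psi>'_d\<xi>[OF p, of 0] linear_0[OF linear_\<psi>'[OF a]] d\<xi>_\<psi>'[OF a, of 0] by (auto simp: p_def)
  then have "hess (\<lambda>y. exp (\<phi> y)) p w w < 0" by (intro neg_def p w)
  moreover have "hess (\<lambda>y. exp (\<phi> y)) p w w = B' a v \<bullet> w"
  proof -
    have "((B \<circ> (\<lambda>t. \<xi> (p + t *\<^sub>R w))) has_vector_derivative B' a v) (at 0)"
      using vector_derivative_diff_chain_within[OF \<xi>_line[OF p w], of B "B' a"]
        has_derivative_at_withinI[OF has_derivative_B[OF a]] by (simp add: ap dw)
    then have "((\<lambda>t. B (\<xi> (p + t *\<^sub>R w)) \<bullet> w) has_real_derivative B' a v \<bullet> w) (at 0)"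
      unfolding has_real_derivative_iff_has_vector_derivative o_def
      by (intro bounded_linear.has_vector_derivative[OF bounded_linear_inner_left])
    moreover have "eventually (\<lambda>t. dir_deriv (\<lambda>y. exp (\<phi> y)) (p + t *\<^sub>R w) w = B (\<xi> (p + t *\<^sub>R w)) \<bullet> w) (nhds 0)"
      using eventually_line_in_simplex[OF p w]
      by (rule eventually_mono)
         (use exp_has_derivative_along_line[OF smooth _ w] in \<open>auto simp: dir_deriv_def B_def intro!: DERIV_imp_deriv\<close>)
    ultimately show ?thesis
      unfolding hess_def by (subst dir_deriv_def) (simp add: deriv_cong_ev DERIV_imp_deriv)
  qed
  ultimately show ?thesis by (simp add: w_def)
qed

lemma in_coords_eq:
  assumes "a \<in> U" "b \<in> U"
  shows "in_coords (L_divergence \<phi>) \<xi> a b = ln (B b \<bullet> \<psi> a) - \<phi> (\<psi> a)"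
  using assms B_pos[of a b]
  unfolding in_coords_def \<psi>_def[symmetric] B_def by (intro L_divergence_eq smooth) auto

lemma Ck_ln_B: "a \<in> U \<Longrightarrow> Ck_on k U (\<lambda>b. ln (B b \<bullet> \<psi> a))"
  by (rule Ck_on_compose[OF open_U _ _ Ck_on_ln])
     (auto intro!: Ck_on_bilinear[OF bounded_bilinear_inner] Ck_on_const Ck_B open_U B_pos)

lemma Ck_in_coords:
  assumes a: "a \<in> U"
  shows "Ck_on k U (\<lambda>b. in_coords (L_divergence \<phi>) \<xi> a b)"
proof (rule Ck_on_cong[OF open_U])
  show "Ck_on k U (\<lambda>b. ln (B b \<bullet> \<psi> a) + - \<phi> (\<psi> a))"
    by (intro Ck_on_add Ck_ln_B Ck_on_const open_U a)
qed (simp add: in_coords_eq a)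

lemma pderivative_in_coords:
  assumes ab: "a \<in> U" "b \<in> U"
  shows "pderivative l (\<lambda>b. in_coords (L_divergence \<phi>) \<xi> a b) b = (B' b (axis l 1) \<bullet> \<psi> a) / (B b \<bullet> \<psi> a)"
proof -
  have "((\<lambda>b. ln (B b \<bullet> \<psi> a) - \<phi> (\<psi> a)) has_derivative (\<lambda>v. (B' b v \<bullet> \<psi> a) / (B b \<bullet> \<psi> a))) (at b)"
    using has_derivative_B[OF ab(2)] B_pos[OF ab] by (auto intro!: derivative_eq_intros simp: divide_inverse)
  from pderivative_eqI[OF this] show ?thesis
    using pderivative_cong[OF open_U ab(2), of "\<lambda>b. in_coords (L_divergence \<phi>) \<xi> a b"
        "\<lambda>b. ln (B b \<bullet> \<psi> a) - \<phi> (\<psi> a)"] in_coords_eq[OF ab(1)] by simp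
qed

text \<open>Only the derivative of the numerator survives, because the numerator \<open>B' x (axis j
  1) \<bullet> \<psi> a\<close> vanishes at \<open>a = x\<close>.\<close>

lemma metric_coeff_eq:
  assumes x: "x \<in> U"
  shows "metric_coeff (L_divergence \<phi>) \<xi> x i j =
     - (B' x (axis j 1) \<bullet> \<psi>' x (axis i 1)) / (B x \<bullet> \<psi> x)"
proof -
  have "((\<lambda>a. (B' x (axis j 1) \<bullet> \<psi> a) / (B x \<bullet> \<psi> a)) has_derivative
      (\<lambda>v. (B' x (axis j 1) \<bullet> \<psi>' x v) / (B x \<bullet> \<psi> x))) (at x)"
    using has_derivative_\<psi>[OF x] B_pos[OF x x] B'_\<psi>[OF x]
    by (auto intro!: derivative_eq_intros simp: divide_simps)
  from pderivative_eqI[OF this] show ?thesis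
    using pderivative_cong[OF open_U x pderivative_in_coords[OF _ x]]
    by (simp add: metric_coeff_def)
qed

text \<open>This is \<open>- Hess \<Phi> / \<Phi>\<close> on the tangent vectors with coordinates
  \<open>u\<close> and \<open>v\<close>, where \<open>\<Phi> = exp \<circ> \<phi>\<close>.\<close>

definition metric_form where "metric_form x u v = - (B' x v \<bullet> \<psi>' x u) / (B x \<bullet> \<psi> x)"

lemma metric_coeff_sum:
  assumes x: "x \<in> U"
  shows "(\<Sum>i\<in>UNIV. \<Sum>j\<in>UNIV. metric_coeff (L_divergence \<phi>) \<xi> x i j * u $ i * v $ j) = metric_form x u v"
proof -
  have "B' x v \<bullet> \<psi>' x u =
    (\<Sum>i\<in>UNIV. \<Sum>j\<in>UNIV. (B' x (axis j 1) \<bullet> \<psi>' x (axis i 1)) * u $ i * v $ j)"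
    unfolding linear_axis_expansion[OF linear_B'[OF x], of v] linear_axis_expansion[OF linear_\<psi>'[OF x], of u]
    by (simp add: inner_sum_left inner_sum_right sum_distrib_left mult_ac)
  then show ?thesis
    by (simp add: metric_form_def metric_coeff_eq[OF x] sum_divide_distrib flip: sum_negf)
qed

lemma metric_form_symmetric: "x \<in> U \<Longrightarrow> metric_form x u v = metric_form x v u"
  by (simp add: metric_form_def B'_\<psi>'_symmetric)

lemma metric_form_positive: "x \<in> U \<Longrightarrow> u \<noteq> 0 \<Longrightarrow> 0 < metric_form x u u"
  using B'_\<psi>'_negative[of x u] B_pos[of x x] by (simp add: metric_form_def divide_neg_pos)

lemma linear_metric_form: "x \<in> U \<Longrightarrow> linear (\<lambda>u. metric_form x u v)"
  unfolding metric_form_def using linear_\<psi>'[of x]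
  by (intro linearI) (auto simp: linear_add linear_cmul inner_add_right add_divide_distrib diff_divide_distrib)

lemma metric_symmetric:
  "x \<in> U \<Longrightarrow> metric_coeff (L_divergence \<phi>) \<xi> x i j = metric_coeff (L_divergence \<phi>) \<xi> x j i"
  by (simp add: metric_coeff_eq B'_\<psi>'_symmetric)

lemma metric_invertible:
  assumes x: "x \<in> U"
  shows "invertible (\<chi> i j. metric_coeff (L_divergence \<phi>) \<xi> x i j)"
proof (rule invertible_if_definite)
  fix v :: "real ^ 'm" assume "v \<noteq> 0"
  have "v \<bullet> ((\<chi> i j. metric_coeff (L_divergence \<phi>) \<xi> x i j) *v v) = metric_form x v v"
    unfolding metric_coeff_sum[OF x, symmetric]
    by (simp add: inner_vec_def matrix_vector_mult_def sum_distrib_left mult_ac)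
  then show "v \<bullet> ((\<chi> i j. metric_coeff (L_divergence \<phi>) \<xi> x i j) *v v) \<noteq> 0"
    using metric_form_positive[OF x \<open>v \<noteq> 0\<close>] by simp
qed

lemma riemannian_inner_eq:
  assumes "q \<in> unit_simplex"
  shows "riemannian_inner (L_divergence \<phi>) \<xi> q u v = metric_form (\<xi> q) (d\<xi> q u) (d\<xi> q v)"
  using metric_coeff_sum[OF \<xi>_in[OF assms], of "d\<xi> q u" "d\<xi> q v"]
  by (simp add: riemannian_inner_def d\<xi>_def)

end

section \<open>Geodesics\<close>

context exp_concave_geometry
begin

text \<open>Common to both connections; \<open>C\<close> stands for the coefficients with three
  lower indices.\<close>

lemma lowered_geodesic_equation:
  assumes "geodesic \<Gamma> \<xi> \<gamma>" and t: "t \<in> {0..1}"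
    and \<Gamma>: "\<And>i j k. \<Gamma> (\<xi> (\<gamma> t)) i j k =
       (\<Sum>m\<in>UNIV. C i j m * inverse_metric (L_divergence \<phi>) \<xi> (\<xi> (\<gamma> t)) $ m $ k)"
  shows "(\<Sum>k\<in>UNIV. metric_coeff (L_divergence \<phi>) \<xi> (\<xi> (\<gamma> t)) k l * velocity (velocity (\<xi> \<circ> \<gamma>)) t $ k) +
    (\<Sum>i\<in>UNIV. \<Sum>j\<in>UNIV. C i j l * velocity (\<xi> \<circ> \<gamma>) t $ i * velocity (\<xi> \<circ> \<gamma>) t $ j) = 0"
proof -
  have "\<gamma> t \<in> unit_simplex" using assms by (auto simp: geodesic_def)
  note inv = metric_invertible[OF \<xi>_in[OF this]]
  have "velocity (velocity (\<xi> \<circ> \<gamma>)) t $ k + (\<Sum>i\<in>UNIV. \<Sum>j\<in>UNIV.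
      (\<Sum>m\<in>UNIV. C i j m * matrix_inv (\<chi> i j. metric_coeff (L_divergence \<phi>) \<xi> (\<xi> (\<gamma> t)) i j) $ m $ k)
        * velocity (\<xi> \<circ> \<gamma>) t $ i * velocity (\<xi> \<circ> \<gamma>) t $ j) = 0" for k
    using assms(1) t unfolding geodesic_def \<Gamma>[unfolded inverse_metric_def, symmetric] by blast
  from lower_acceleration_index[OF inv this] show ?thesis by simp
qed

lemma
  assumes \<gamma>: "smooth_on {0..1} \<gamma>" "\<gamma> ` {0..1} \<subseteq> unit_simplex"
  shows smooth_coords: "smooth_on {0..1} (\<xi> \<circ> \<gamma>)"
    and smooth_B_curve: "smooth_on {0..1} (\<lambda>s. B (\<xi> (\<gamma> s)))"
    and coords_curve_in_U: "(\<xi> \<circ> \<gamma>) ` {0..1} \<subseteq> U"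
    and curve_in_simplex: "\<And>t. t \<in> {0..1} \<Longrightarrow> \<gamma> t \<in> unit_simplex"
proof -
  show s: "smooth_on {0..1} (\<xi> \<circ> \<gamma>)" using smooth_on_compose[OF \<gamma>(1) smooth_\<xi> \<gamma>(2)] by (simp add: o_def)
  show i: "(\<xi> \<circ> \<gamma>) ` {0..1} \<subseteq> U" using \<gamma>(2) by auto
  show "smooth_on {0..1} (\<lambda>s. B (\<xi> (\<gamma> s)))" using smooth_on_compose[OF s smooth_B i] by simp
  show "\<And>t. t \<in> {0..1} \<Longrightarrow> \<gamma> t \<in> unit_simplex" using \<gamma>(2) by blast
qed

context
  fixes \<gamma> :: "real \<Rightarrow> real ^ 'n" and t :: real
  assumes \<gamma>: "smooth_on {0..1} \<gamma>" "\<gamma> ` {0..1} \<subseteq> unit_simplex" and t: "t \<in> {0..1}"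
begin

lemma velocity_B_curve: "velocity (\<lambda>s. B (\<xi> (\<gamma> s))) t = B' (\<xi> (\<gamma> t)) (velocity (\<xi> \<circ> \<gamma>) t)"
proof (rule velocity_eqI[OF _ t])
  show "((\<lambda>s. B (\<xi> (\<gamma> s))) has_vector_derivative B' (\<xi> (\<gamma> t)) (velocity (\<xi> \<circ> \<gamma>) t)) (at t within {0..1})"
    using vector_derivative_diff_chain_within[OF has_vector_derivative_velocity[OF smooth_coords[OF \<gamma>] t], of B]
      has_derivative_at_withinI[OF has_derivative_B] curve_in_simplex[OF \<gamma> t] by (simp add: o_def)
qed

lemma \<psi>'_velocity: "\<psi>' (\<xi> (\<gamma> t)) (velocity (\<xi> \<circ> \<gamma>) t) = velocity \<gamma> t"
proof (rule velocity_eqI[OF _ t, symmetric])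
  have "((\<lambda>s. \<psi> (\<xi> (\<gamma> s))) has_vector_derivative \<psi>' (\<xi> (\<gamma> t)) (velocity (\<xi> \<circ> \<gamma>) t)) (at t within {0..1})"
    using vector_derivative_diff_chain_within[OF has_vector_derivative_velocity[OF smooth_coords[OF \<gamma>] t], of \<psi>]
      has_derivative_at_withinI[OF has_derivative_\<psi>] curve_in_simplex[OF \<gamma> t] by (simp add: o_def)
  then show "(\<gamma> has_vector_derivative \<psi>' (\<xi> (\<gamma> t)) (velocity (\<xi> \<circ> \<gamma>) t)) (at t within {0..1})"
    by (rule has_vector_derivative_transform[OF t, rotated]) (use curve_in_simplex[OF \<gamma>] in auto)
qed

lemma velocity_tangent: "velocity \<gamma> t \<in> tangent_space"
  using \<psi>'_velocity \<psi>'_tangent[OF \<xi>_in[OF curve_in_simplex[OF \<gamma> t]]] by metis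

lemma d\<xi>_velocity: "d\<xi> (\<gamma> t) (velocity \<gamma> t) = velocity (\<xi> \<circ> \<gamma>) t"
  using d\<xi>_\<psi>'[OF \<xi>_in[OF curve_in_simplex[OF \<gamma> t]]] \<psi>'_velocity curve_in_simplex[OF \<gamma> t] by (metis \<psi>_\<xi>)

lemma exp_\<phi>_velocity:
  "((\<lambda>s. exp (\<phi> (\<gamma> s))) has_real_derivative B (\<xi> (\<gamma> t)) \<bullet> velocity \<gamma> t) (at t within {0..1})"
proof -
  have "((\<lambda>s. exp (\<phi> (\<psi> (\<xi> (\<gamma> s))))) has_real_derivative B (\<xi> (\<gamma> t)) \<bullet> velocity \<gamma> t) (at t within {0..1})"
    unfolding has_real_derivative_iff_has_vector_derivative
    using vector_derivative_diff_chain_within[OF has_vector_derivative_velocity[OF smooth_coords[OF \<gamma>] t]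
        has_derivative_at_withinI[OF exp_\<phi>_\<psi>_has_derivative]] curve_in_simplex[OF \<gamma> t]
    by (simp add: o_def \<psi>'_velocity[unfolded o_def])
  then show ?thesis
    unfolding has_real_derivative_iff_has_vector_derivative
    by (rule has_vector_derivative_transform[OF t, rotated]) (use curve_in_simplex[OF \<gamma>] in auto)
qed

end

lemma acceleration_tangent:
  fixes \<gamma> :: "real \<Rightarrow> real ^ 'n"
  assumes \<gamma>: "smooth_on {0..1} \<gamma>" "\<gamma> ` {0..1} \<subseteq> unit_simplex" and t: "t \<in> {0..1}"
  shows "velocity (velocity \<gamma>) t \<in> tangent_space"
proof -
  have ones: "(\<Sum>i\<in>UNIV. v $ i) = v \<bullet> (\<chi> i. 1)" for v :: "real ^ 'n" by (simp add: inner_vec_def)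
  have d: "((\<lambda>s. velocity \<gamma> s \<bullet> (\<chi> i. 1)) has_real_derivative velocity (velocity \<gamma>) t \<bullet> (\<chi> i. 1)) (at t within {0..1})"
    by (intro has_real_derivative_inner_velocity smooth_on_velocity \<gamma> t)
  have "velocity \<gamma> s \<bullet> (\<chi> i. 1) = 0" if "s \<in> {0..1}" for s
    using velocity_tangent[OF \<gamma> that] by (simp add: tangent_space_def ones)
  then have "((\<lambda>s. velocity \<gamma> s \<bullet> (\<chi> i. 1)) has_real_derivative 0) (at t within {0..1})"
    unfolding has_real_derivative_iff_has_vector_derivative
    by (intro has_vector_derivative_transform[OF t _ has_vector_derivative_const[of 0]])
  then have "velocity (velocity \<gamma>) t \<bullet> (\<chi> i. 1) = 0"
    using velocity_realI[OF d t] velocity_realI t by metis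
  then show ?thesis by (simp add: tangent_space_def ones)
qed

text \<open>A vector with these properties is orthogonal to every tangent vector in the metric, in
  particular to itself.\<close>

lemma tangent_vector_eq_0_if_orthogonal:
  assumes x: "x \<in> U" and z: "z \<in> tangent_space" and orth: "\<And>l. B' x (axis l 1) \<bullet> z = 0"
  shows "z = 0"
proof -
  define v where "v = d\<xi> (\<psi> x) z"
  have zv: "\<psi>' x v = z" using \<psi>'_d\<xi>[OF \<psi>_in[OF x] z] x by (simp add: v_def)
  have "B' x v \<bullet> z = 0"
    unfolding linear_axis_expansion[OF linear_B'[OF x], of v] by (simp add: inner_sum_left orth)
  then have "v = 0" using B'_\<psi>'_negative[OF x, of v] zv by fastforce
  then show ?thesis using zv linear_0[OF linear_\<psi>'[OF x]] by simp
qed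

lemma Ck_quotient:
  assumes x: "x \<in> U"
  shows "Ck_on k U (\<lambda>a. (\<beta> \<bullet> \<psi> a) / (B x \<bullet> \<psi> a))"
  unfolding divide_inverse
  by (intro Ck_on_bilinear[OF bounded_bilinear_mult] Ck_on_bilinear[OF bounded_bilinear_inner]
      Ck_on_const open_U Ck_\<psi> Ck_on_compose[OF open_U _ _ Ck_on_inverse])
     (use B_pos x in force)

text \<open>With the index \<open>l\<close> lowered, the geodesic equation at time \<open>t\<close>
  says that the function \<open>P a = (B' x (axis l 1) \<bullet> \<psi> a) / (B x \<bullet> \<psi>
  a)\<close>, with \<open>x\<close> the coordinates of \<open>\<gamma> t\<close> held fixed, has
  vanishing second derivative along the curve at time \<open>t\<close>. As \<open>\<psi> a\<close>
  runs through \<open>\<gamma>\<close> itself, this is a quotient of linear functions of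
  \<open>\<gamma>\<close> whose numerator vanishes at time \<open>t\<close>; it says that
  \<open>z\<close>, the difference of the two sides of the claim, is annihilated by \<open>B' x
  (axis l 1)\<close>. This for all \<open>l\<close> gives \<open>z = 0\<close>.\<close>

lemma primal_acceleration:
  assumes geo: "primal_geodesic (L_divergence \<phi>) \<xi> \<gamma>" and t: "t \<in> {0..1}"
  shows "velocity (velocity \<gamma>) t =
     (2 * (B (\<xi> (\<gamma> t)) \<bullet> velocity \<gamma> t) / exp (\<phi> (\<gamma> t))) *\<^sub>R velocity \<gamma> t"
proof -
  let ?D = "L_divergence \<phi>"
  have \<gamma>: "smooth_on {0..1} \<gamma>" "\<gamma> ` {0..1} \<subseteq> unit_simplex"
    using geo by (auto simp: primal_geodesic_def geodesic_def)
  define x where "x = \<xi> (\<gamma> t)"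
  have x: "x \<in> U" and \<psi>x: "\<psi> x = \<gamma> t" using curve_in_simplex[OF \<gamma> t] by (auto simp: x_def)
  let ?m = "2 * (B x \<bullet> velocity \<gamma> t) / exp (\<phi> (\<gamma> t))"
  define z where "z = velocity (velocity \<gamma>) t - ?m *\<^sub>R velocity \<gamma> t"
  have f: "\<gamma> t \<bullet> B x = exp (\<phi> (\<gamma> t))" using B_\<psi>[OF x] by (simp add: \<psi>x inner_commute)
  have "z = 0"
  proof (rule tangent_vector_eq_0_if_orthogonal[OF x])
    show "z \<in> tangent_space"
      unfolding z_def
      by (intro subspace_diff subspace_scale subspace_tangent_space acceleration_tangent[OF \<gamma> t] velocity_tangent[OF \<gamma> t])
    fix l
    define P where "P a = (B' x (axis l 1) \<bullet> \<psi> a) / (B x \<bullet> \<psi> a)" for a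
    have P: "Ck_on 2 U P" unfolding P_def by (rule Ck_quotient[OF x])
    have pd1: "pderivative j (\<lambda>a. pderivative l (\<lambda>b. in_coords ?D \<xi> a b) x) y = pderivative j P y"
      if "y \<in> U" for j y
      by (rule pderivative_cong[OF open_U that]) (simp add: P_def pderivative_in_coords x)
    have pd2: "primal_coeff ?D \<xi> x i j l = - pderivative i (pderivative j P) x" for i j
      unfolding primal_coeff_def
      by (rule arg_cong[where f = uminus], rule pderivative_cong[OF open_U x]) (rule pd1)
    have pd3: "metric_coeff ?D \<xi> x k l = - pderivative k P x" for k
      unfolding metric_coeff_def by (simp add: pd1[OF x])
    have "velocity (velocity (\<lambda>s. P ((\<xi> \<circ> \<gamma>) s))) t = 0"
      using lowered_geodesic_equation[OF geo[unfolded primal_geodesic_def] t, of "primal_coeff ?D \<xi> x" l]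
      unfolding second_velocity_compose[OF open_U P smooth_coords[OF \<gamma>] coords_curve_in_U[OF \<gamma>] t]
      by (simp add: primal_christoffel_def x_def[symmetric] pd2 pd3 sum_negf)
    moreover have "velocity (velocity (\<lambda>s. P ((\<xi> \<circ> \<gamma>) s))) t = velocity (velocity (\<lambda>s. (\<gamma> s \<bullet> B' x (axis l 1)) / (\<gamma> s \<bullet> B x))) t"
      using curve_in_simplex[OF \<gamma>] t by (intro velocity_cong) (simp_all add: P_def inner_commute)
    moreover have "\<dots> = (velocity (velocity \<gamma>) t \<bullet> B' x (axis l 1)) / (\<gamma> t \<bullet> B x)
       - 2 * (velocity \<gamma> t \<bullet> B' x (axis l 1)) * (velocity \<gamma> t \<bullet> B x) / (\<gamma> t \<bullet> B x)\<^sup>2"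
    proof (rule second_velocity_quotient[OF \<gamma>(1) t])
      show "0 < \<gamma> s \<bullet> B x" if "s \<in> {0..1}" for s
        using B_pos[OF \<xi>_in[OF curve_in_simplex[OF \<gamma> that]] x] curve_in_simplex[OF \<gamma> that] by (simp add: inner_commute)
      show "\<gamma> t \<bullet> B' x (axis l 1) = 0"
        using B'_\<psi>[OF x, of "axis l 1"] by (simp add: \<psi>x inner_commute)
    qed
    ultimately show "B' x (axis l 1) \<bullet> z = 0"
      by (simp add: z_def f inner_diff_right inner_commute field_simps power2_eq_square)
  qed
  then show ?thesis by (simp add: z_def x_def)
qed

text \<open>By the preceding lemma \<open>\<gamma>' / (exp (\<phi> \<circ>
  \<gamma>))\<^sup>2\<close> has derivative 0, so the component of the velocity in direction
  \<open>h\<close> at any time is a positive multiple of its initial value. The factor depends on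
  \<open>h\<close> here, since it comes from the mean value theorem; one \<open>h\<close> is enough
  for the theorem.\<close>

lemma primal_geodesic_direction:
  assumes geo: "primal_geodesic (L_divergence \<phi>) \<xi> \<gamma>"
  obtains m where "0 < m" "(\<gamma> 1 - \<gamma> 0) \<bullet> h = m * (velocity \<gamma> 0 \<bullet> h)"
proof -
  have \<gamma>: "smooth_on {0..1} \<gamma>" "\<gamma> ` {0..1} \<subseteq> unit_simplex"
    using geo by (auto simp: primal_geodesic_def geodesic_def)
  define f where "f s = exp (\<phi> (\<gamma> s))" for s
  have f0: "0 < f s" for s by (simp add: f_def)
  have g': "((\<lambda>s. (velocity \<gamma> s \<bullet> h) / (f s)\<^sup>2) has_real_derivative 0) (at s within {0..1})"
    if s: "s \<in> {0..1}" for s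
  proof -
    have f': "(f has_real_derivative B (\<xi> (\<gamma> s)) \<bullet> velocity \<gamma> s) (at s within {0..1})"
      unfolding f_def by (rule exp_\<phi>_velocity[OF \<gamma> s])
    have v': "((\<lambda>s. velocity \<gamma> s \<bullet> h) has_real_derivative
        2 * (B (\<xi> (\<gamma> s)) \<bullet> velocity \<gamma> s) / f s * (velocity \<gamma> s \<bullet> h)) (at s within {0..1})"
      using has_real_derivative_inner_velocity[OF smooth_on_velocity[OF \<gamma>(1)] s]
        primal_acceleration[OF geo s] by (simp add: f_def)
    show ?thesis
      by (rule derivative_eq_intros f' v' refl)+
         (use f0[of s] in \<open>auto simp: field_simps power2_eq_square\<close>)
  qed
  have const: "(velocity \<gamma> s \<bullet> h) / (f s)\<^sup>2 = (velocity \<gamma> 0 \<bullet> h) / (f 0)\<^sup>2" if "s \<in> {0..1}" for s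
    by (rule constant_on_unit_interval[OF g' that])
  obtain s where s: "s \<in> {0..1}" "\<gamma> 1 \<bullet> h - \<gamma> 0 \<bullet> h = velocity \<gamma> s \<bullet> h"
    using mvt_within_unit_interval[OF has_real_derivative_inner_velocity[OF \<gamma>(1)]] by metis
  have "velocity \<gamma> s \<bullet> h = ((f s)\<^sup>2 / (f 0)\<^sup>2) * (velocity \<gamma> 0 \<bullet> h)"
    using const[OF s(1)] f0[of s] f0[of 0] by (simp add: field_simps)
  moreover have "0 < (f s)\<^sup>2 / (f 0)\<^sup>2" using f0[of s] f0[of 0] by simp
  ultimately show thesis
    using s by (intro that[of "(f s)\<^sup>2 / (f 0)\<^sup>2"]) (simp_all add: inner_diff_left)
qed

text \<open>For each fixed \<open>a\<close> the second derivative at time \<open>t\<close> of the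
  divergence from the curve to \<open>a\<close>, as a function of the base point, is computed in two
  ways: with partial derivatives in coordinates, and from \<open>ln (Y s \<bullet> \<psi>
  a)\<close>. The first expression, differentiated in the \<open>l\<close>-th coordinate of
  \<open>a\<close> at \<open>a = x\<close>, is the lowered dual geodesic equation and hence 0. The
  second then gives that \<open>Y'' - \<kappa> Y\<close>, with \<open>\<kappa> = (Y'' \<bullet>
  \<psi> x) / (Y \<bullet> \<psi> x)\<close>, is orthogonal to all tangent vectors. By the choice of
  \<open>\<kappa>\<close> it is also orthogonal to the point \<open>\<psi> x\<close>, and together
  these span the whole space.\<close>

lemma dual_acceleration:
  assumes geo: "dual_geodesic (L_divergence \<phi>) \<xi> \<gamma>" and t: "t \<in> {0..1}"
  defines "Y \<equiv> \<lambda>s. B (\<xi> (\<gamma> s))"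
  obtains \<kappa> where "velocity (velocity Y) t = \<kappa> *\<^sub>R Y t"
proof -
  let ?D = "L_divergence \<phi>"
  have \<gamma>: "smooth_on {0..1} \<gamma>" "\<gamma> ` {0..1} \<subseteq> unit_simplex"
    using geo by (auto simp: dual_geodesic_def geodesic_def)
  define x where "x = \<xi> (\<gamma> t)"
  have x: "x \<in> U" and \<psi>x: "\<psi> x = \<gamma> t" using curve_in_simplex[OF \<gamma> t] by (auto simp: x_def)
  have Y: "smooth_on {0..1} Y" unfolding Y_def by (rule smooth_B_curve[OF \<gamma>])
  have Yt: "Y t = B x" by (simp add: Y_def x_def)
  define Y1 where "Y1 = velocity Y t"
  define Y2 where "Y2 = velocity (velocity Y) t"
  define u where "u = velocity (\<xi> \<circ> \<gamma>) t"
  define w where "w = velocity (velocity (\<xi> \<circ> \<gamma>)) t"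
  have Y1: "Y1 \<bullet> \<psi> x = 0" unfolding Y1_def Y_def velocity_B_curve[OF \<gamma> t]
    by (fold x_def) (rule B'_\<psi>[OF x])
  define Bj where "Bj j = B' x (axis j 1)" for j
  define Bij where "Bij i j = frechet_derivative (\<lambda>b. B' b (axis j 1)) (at x) (axis i 1)" for i j
  have dBj: "((\<lambda>b. B' b (axis j 1)) has_derivative frechet_derivative (\<lambda>b. B' b (axis j 1)) (at x)) (at x)" for j
    using Ck_B[of "Suc (Suc 0)"] by (intro Ck_on_SucD[OF _ x, of 0]) (simp add: B'_def)
  define Q where "Q a b = in_coords ?D \<xi> a b" for a b
  define R1 where "R1 j a = (Bj j \<bullet> \<psi> a) / (B x \<bullet> \<psi> a)" for j a
  define R2 where "R2 i j a = (Bij i j \<bullet> \<psi> a) / (B x \<bullet> \<psi> a) + (- R1 j a) * R1 i a" for i j a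
  have Q1: "pderivative j (Q a) x = R1 j a" if "a \<in> U" for a j
    unfolding Q_def R1_def Bj_def by (rule pderivative_in_coords[OF that x])
  have Q2: "pderivative i (pderivative j (Q a)) x = R2 i j a" if a: "a \<in> U" for a i j
  proof -
    have "pderivative i (pderivative j (Q a)) x = pderivative i (\<lambda>b. (B' b (axis j 1) \<bullet> \<psi> a) / (B b \<bullet> \<psi> a)) x"
      unfolding Q_def by (intro pderivative_cong[OF open_U x] pderivative_in_coords a)
    also have "\<dots> = R2 i j a"
    proof -
      have "((\<lambda>b. (B' b (axis j 1) \<bullet> \<psi> a) / (B b \<bullet> \<psi> a)) has_derivative
        (\<lambda>v. (frechet_derivative (\<lambda>b. B' b (axis j 1)) (at x) v \<bullet> \<psi> a) / (B x \<bullet> \<psi> a)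
           - (Bj j \<bullet> \<psi> a) * (B' x v \<bullet> \<psi> a) / (B x \<bullet> \<psi> a)\<^sup>2)) (at x)"
        using dBj[of j] has_derivative_B[OF x] B_pos[OF a x]
        by (auto intro!: derivative_eq_intros simp: Bj_def field_simps power2_eq_square)
      from pderivative_eqI[OF this] show ?thesis
        by (simp add: R2_def R1_def Bij_def Bj_def power2_eq_square)
    qed
    finally show ?thesis .
  qed
  have CR1: "Ck_on 1 U (R1 j)" for j
    unfolding R1_def by (rule Ck_quotient[OF x])
  have CR2: "Ck_on 1 U (R2 i j)" for i j
    unfolding R2_def
    by (intro Ck_on_add Ck_on_bilinear[OF bounded_bilinear_mult] Ck_quotient x CR1 open_U
        Ck_on_compose[OF open_U subset_UNIV CR1 Ck_on_linear] bounded_linear_minus bounded_linear_ident) auto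
  have dR: "(R1 j has_derivative frechet_derivative (R1 j) (at x)) (at x)"
    "(R2 i j has_derivative frechet_derivative (R2 i j) (at x)) (at x)" for i j
    using CR1 CR2 Ck_on_SucD[OF _ x] by (metis One_nat_def)+
  have key: "(\<Sum>j\<in>UNIV. R1 j a * w $ j) + (\<Sum>i\<in>UNIV. \<Sum>j\<in>UNIV. R2 i j a * u $ i * u $ j)
     = (Y2 \<bullet> \<psi> a) / (B x \<bullet> \<psi> a) - (Y1 \<bullet> \<psi> a)\<^sup>2 / (B x \<bullet> \<psi> a)\<^sup>2" if a: "a \<in> U" for a
  proof -
    have "Ck_on 2 U (Q a)" unfolding Q_def by (rule Ck_in_coords[OF a])
    from second_velocity_compose[OF open_U this smooth_coords[OF \<gamma>] coords_curve_in_U[OF \<gamma>] t]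
    have "(\<Sum>j\<in>UNIV. R1 j a * w $ j) + (\<Sum>i\<in>UNIV. \<Sum>j\<in>UNIV. R2 i j a * u $ i * u $ j)
      = velocity (velocity (\<lambda>s. Q a ((\<xi> \<circ> \<gamma>) s))) t"
      by (simp add: Q1[OF a] Q2[OF a] u_def w_def x_def[symmetric])
    also have "\<dots> = velocity (velocity (\<lambda>s. ln (Y s \<bullet> \<psi> a) - \<phi> (\<psi> a))) t"
      using curve_in_simplex[OF \<gamma>] t a by (intro velocity_cong) (simp_all add: Q_def Y_def in_coords_eq)
    also have "\<dots> = (Y2 \<bullet> \<psi> a) / (B x \<bullet> \<psi> a) - (Y1 \<bullet> \<psi> a)\<^sup>2 / (B x \<bullet> \<psi> a)\<^sup>2"
      unfolding Y1_def Y2_def Yt[symmetric]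
      by (intro second_velocity_ln Y t) (use B_pos[OF a] curve_in_simplex[OF \<gamma>] in \<open>auto simp: Y_def\<close>)
    finally show ?thesis .
  qed
  define \<kappa> where "\<kappa> = (Y2 \<bullet> \<psi> x) / (B x \<bullet> \<psi> x)"
  have f: "0 < B x \<bullet> \<psi> x" by (rule B_pos[OF x x])
  have orth: "(Y2 - \<kappa> *\<^sub>R B x) \<bullet> \<psi>' x (axis l 1) = 0" for l
  proof -
    let ?e = "axis l 1 :: real ^ 'm"
    have "((\<lambda>a. (Y2 \<bullet> \<psi> a) / (B x \<bullet> \<psi> a) - (Y1 \<bullet> \<psi> a)\<^sup>2 / (B x \<bullet> \<psi> a)\<^sup>2) has_derivative
       (\<lambda>v. (Y2 \<bullet> \<psi>' x v) / (B x \<bullet> \<psi> x) - (Y2 \<bullet> \<psi> x) * (B x \<bullet> \<psi>' x v) / (B x \<bullet> \<psi> x)\<^sup>2)) (at x)"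
      using has_derivative_\<psi>[OF x] f Y1
      by (auto intro!: derivative_eq_intros simp: field_simps power2_eq_square)
    moreover have "((\<lambda>a. (Y2 \<bullet> \<psi> a) / (B x \<bullet> \<psi> a) - (Y1 \<bullet> \<psi> a)\<^sup>2 / (B x \<bullet> \<psi> a)\<^sup>2) has_derivative
       (\<lambda>v. (\<Sum>j\<in>UNIV. frechet_derivative (R1 j) (at x) v * w $ j) +
         (\<Sum>i\<in>UNIV. \<Sum>j\<in>UNIV. frechet_derivative (R2 i j) (at x) v * u $ i * u $ j))) (at x)"
      by (rule has_derivative_transform_within_open[OF _ open_U x key])
         (intro has_derivative_add has_derivative_sum has_derivative_mult_left dR)
    ultimately have "(Y2 \<bullet> \<psi>' x ?e) / (B x \<bullet> \<psi> x) - (Y2 \<bullet> \<psi> x) * (B x \<bullet> \<psi>' x ?e) / (B x \<bullet> \<psi> x)\<^sup>2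
      = (\<Sum>j\<in>UNIV. frechet_derivative (R1 j) (at x) ?e * w $ j) +
         (\<Sum>i\<in>UNIV. \<Sum>j\<in>UNIV. frechet_derivative (R2 i j) (at x) ?e * u $ i * u $ j)"
      by (rule fun_cong[OF has_derivative_unique])
    also have "\<dots> = 0"
    proof -
      have m: "metric_coeff ?D \<xi> x l j = - frechet_derivative (R1 j) (at x) ?e" for j
        unfolding metric_coeff_def Q_def[symmetric]
        by (subst pderivative_cong[OF open_U x Q1]) (simp_all add: pderivative_eqI[OF dR(1)])
      have d: "dual_coeff ?D \<xi> x i j l = - frechet_derivative (R2 i j) (at x) ?e" for i j
        unfolding dual_coeff_def Q_def[symmetric]
        by (subst pderivative_cong[OF open_U x Q2]) (simp_all add: pderivative_eqI[OF dR(2)])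
      show ?thesis
        using lowered_geodesic_equation[OF geo[unfolded dual_geodesic_def] t, of "dual_coeff ?D \<xi> x" l]
        by (simp add: dual_christoffel_def x_def[symmetric] u_def[symmetric] w_def[symmetric]
            metric_symmetric[OF x, of _ l] m d sum_negf)
    qed
    finally show ?thesis using f
      by (simp add: \<kappa>_def inner_diff_left field_simps power2_eq_square)
  qed
  have "Y2 - \<kappa> *\<^sub>R B x = 0"
  proof -
    define n where "n = Y2 - \<kappa> *\<^sub>R B x"
    have tang: "n \<bullet> z = 0" if "z \<in> tangent_space" for z
    proof -
      have "z = \<psi>' x (d\<xi> (\<psi> x) z)" using \<psi>'_d\<xi>[OF \<psi>_in[OF x] that] x by simp
      also have "\<dots> = (\<Sum>i\<in>UNIV. d\<xi> (\<psi> x) z $ i *\<^sub>R \<psi>' x (axis i 1))"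
        by (rule linear_axis_expansion[OF linear_\<psi>'[OF x]])
      finally have "n \<bullet> z = n \<bullet> (\<Sum>i\<in>UNIV. d\<xi> (\<psi> x) z $ i *\<^sub>R \<psi>' x (axis i 1))" by simp
      then show ?thesis using orth by (simp add: n_def inner_sum_right)
    qed
    \<comment> \<open>split \<open>n\<close> itself into a tangent vector and a multiple of the point \<open>\<psi> x\<close>\<close>
    have "n - (\<Sum>i\<in>UNIV. n $ i) *\<^sub>R \<psi> x \<in> tangent_space"
      using \<psi>_in[OF x] by (simp add: tangent_space_def unit_simplex_def sum_subtractf flip: sum_distrib_left)
    from tang[OF this] have "n \<bullet> n = (\<Sum>i\<in>UNIV. n $ i) * (n \<bullet> \<psi> x)" by (simp add: inner_diff_right)
    also have "n \<bullet> \<psi> x = 0" using f by (simp add: n_def \<kappa>_def inner_diff_left)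
    finally show ?thesis by (simp add: n_def)
  qed
  with that[of \<kappa>] show thesis by (simp add: Y2_def Yt)
qed

text \<open>The Wronskian \<open>W\<close> of \<open>Y \<bullet> r\<close> and \<open>Y \<bullet>
  q\<close> is constant because both functions solve \<open>y'' = \<kappa> y\<close>, and it is the
  numerator of the derivative of their quotient. At time 0 it is \<open>(Y' 0 \<bullet> r) (Y 0
  \<bullet> q)\<close>, as \<open>Y' 0\<close> annihilates the base point \<open>q\<close> of
  \<open>Y 0\<close>.\<close>

lemma dual_geodesic_cross_ratio:
  assumes geo: "dual_geodesic (L_divergence \<phi>) \<xi> \<gamma>" and r: "r \<in> unit_simplex"
  defines "Y \<equiv> \<lambda>s. B (\<xi> (\<gamma> s))"
  obtains m where "0 < m"
    "(Y 1 \<bullet> r) / (Y 1 \<bullet> \<gamma> 0) - (Y 0 \<bullet> r) / (Y 0 \<bullet> \<gamma> 0) = m * (velocity Y 0 \<bullet> (r - \<gamma> 0))"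
proof -
  have \<gamma>: "smooth_on {0..1} \<gamma>" "\<gamma> ` {0..1} \<subseteq> unit_simplex"
    using geo by (auto simp: dual_geodesic_def geodesic_def)
  have Y: "smooth_on {0..1} Y" unfolding Y_def by (rule smooth_B_curve[OF \<gamma>])
  define q where "q = \<gamma> 0"
  have q: "q \<in> unit_simplex" using curve_in_simplex[OF \<gamma>, of 0] by (simp add: q_def)
  have pos: "0 < Y s \<bullet> z" if "s \<in> {0..1}" "z \<in> unit_simplex" for s z
    using B_pos[OF \<xi>_in[OF that(2)] \<xi>_in[OF curve_in_simplex[OF \<gamma> that(1)]]] that(2) by (simp add: Y_def)
  define W where "W s = (velocity Y s \<bullet> r) * (Y s \<bullet> q) - (Y s \<bullet> r) * (velocity Y s \<bullet> q)" for s
  have W': "(W has_real_derivative 0) (at s within {0..1})" if s: "s \<in> {0..1}" for s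
  proof -
    obtain \<kappa> where \<kappa>: "velocity (velocity Y) s = \<kappa> *\<^sub>R Y s"
      using dual_acceleration[OF geo s] unfolding Y_def by metis
    note d = has_real_derivative_inner_velocity[OF Y s]
      has_real_derivative_inner_velocity[OF smooth_on_velocity[OF Y] s]
    show ?thesis unfolding W_def
      by (rule derivative_eq_intros d refl)+ (simp add: \<kappa> algebra_simps)
  qed
  have const: "W s = W 0" if "s \<in> {0..1}" for s
    by (rule constant_on_unit_interval[OF W' that])
  have "((\<lambda>s. (Y s \<bullet> r) / (Y s \<bullet> q)) has_real_derivative W s / ((Y s \<bullet> q) * (Y s \<bullet> q))) (at s within {0..1})"
    if s: "s \<in> {0..1}" for s
    unfolding W_def using pos[OF s q]
    by (intro DERIV_divide has_real_derivative_inner_velocity Y s) auto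
  then obtain s where s: "s \<in> {0..1}"
    "(Y 1 \<bullet> r) / (Y 1 \<bullet> q) - (Y 0 \<bullet> r) / (Y 0 \<bullet> q) = W s / ((Y s \<bullet> q) * (Y s \<bullet> q))"
    by (rule mvt_within_unit_interval)
  have "velocity Y 0 \<bullet> q = 0"
    unfolding Y_def using velocity_B_curve[OF \<gamma>, of 0] B'_\<psi>[OF \<xi>_in[OF q]] q by (simp add: q_def)
  then have "W 0 = (velocity Y 0 \<bullet> (r - q)) * (Y 0 \<bullet> q)" by (simp add: W_def inner_diff_right)
  then have "(Y 1 \<bullet> r) / (Y 1 \<bullet> q) - (Y 0 \<bullet> r) / (Y 0 \<bullet> q) =
      (Y 0 \<bullet> q) / ((Y s \<bullet> q) * (Y s \<bullet> q)) * (velocity Y 0 \<bullet> (r - q))"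
    using s const[OF s(1)] by simp
  with that[of "(Y 0 \<bullet> q) / ((Y s \<bullet> q) * (Y s \<bullet> q))"] show thesis
    using pos[OF s(1) q] pos[of 0, OF _ q] by (simp add: q_def)
qed

end

section \<open>The generalized Pythagorean theorem\<close>

theorem theorem1p2:
  fixes \<phi> :: "real ^ 'n \<Rightarrow> real"
    and \<xi> :: "real ^ 'n \<Rightarrow> real ^ 'm"
    and p q r :: "real ^ 'n"
    and \<gamma>d \<gamma> :: "real \<Rightarrow> real ^ 'n"
  assumes "CARD('n) \<ge> 2"
    and "smooth_on unit_simplex \<phi>"
    and "exponentially_concave \<phi>"
    and "\<And>x v. x \<in> unit_simplex \<Longrightarrow> v \<in> tangent_space \<Longrightarrow> v \<noteq> 0 \<Longrightarrow>
           hess (\<lambda>y. exp (\<phi> y)) x v v < 0"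
    and "CARD('m) + 1 = CARD('n)"
    and "coordinate_system \<xi>"
    and "p \<in> unit_simplex" and "q \<in> unit_simplex" and "r \<in> unit_simplex"
    and "dual_geodesic (L_divergence \<phi>) \<xi> \<gamma>d" and "\<gamma>d 0 = q" and "\<gamma>d 1 = p"
    and "primal_geodesic (L_divergence \<phi>) \<xi> \<gamma>" and "\<gamma> 0 = q" and "\<gamma> 1 = r"
  shows "let diff = L_divergence \<phi> q p + L_divergence \<phi> r q - L_divergence \<phi> r p;
             inner_q = riemannian_inner (L_divergence \<phi>) \<xi> q (velocity \<gamma>d 0) (velocity \<gamma> 0);
             angle_q = riemannian_angle (L_divergence \<phi>) \<xi> q (velocity \<gamma>d 0) (velocity \<gamma> 0)
         in (0 < diff \<longleftrightarrow> angle_q < pi / 2) \<and> (angle_q < pi / 2 \<longleftrightarrow> 0 < inner_q) \<and>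
            (diff = 0 \<longleftrightarrow> angle_q = pi / 2) \<and> (angle_q = pi / 2 \<longleftrightarrow> inner_q = 0) \<and>
            (diff < 0 \<longleftrightarrow> pi / 2 < angle_q) \<and> (pi / 2 < angle_q \<longleftrightarrow> inner_q < 0)"
proof -
  interpret exp_concave_geometry \<phi> \<xi>
    using assms by unfold_locales auto
  note p = assms(7) and q = assms(8) and r = assms(9) and dual = assms(10) and primal = assms(13)
  define u where "u = velocity \<gamma>d 0"
  define v where "v = velocity \<gamma> 0"
  define diff where "diff = L_divergence \<phi> q p + L_divergence \<phi> r q - L_divergence \<phi> r p"
  define inner_q where "inner_q = riemannian_inner (L_divergence \<phi>) \<xi> q u v"
  define angle_q where "angle_q = riemannian_angle (L_divergence \<phi>) \<xi> q u v"
  have \<gamma>d: "smooth_on {0..1} \<gamma>d" "\<gamma>d ` {0..1} \<subseteq> unit_simplex"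
    using dual by (auto simp: dual_geodesic_def geodesic_def)
  have \<gamma>: "smooth_on {0..1} \<gamma>" "\<gamma> ` {0..1} \<subseteq> unit_simplex"
    using primal by (auto simp: primal_geodesic_def geodesic_def)
  define x where "x = \<xi> q"
  have x: "x \<in> U" "\<psi> x = q" using q by (simp_all add: x_def)
  have B: "B (\<xi> z) = support_vector \<phi> z" if "z \<in> unit_simplex" for z
    using that by (simp add: B_def)
  have pos: "0 < support_vector \<phi> y \<bullet> z" if "y \<in> unit_simplex" "z \<in> unit_simplex" for y z
    using B_pos[OF \<xi>_in[OF that(2)] \<xi>_in[OF that(1)]] that by (simp add: B)
  \<comment> \<open>the initial velocity of the support vectors along the dual geodesic\<close>
  define h where "h = B' x (d\<xi> q u)"
  have inner_h: "inner_q = - (h \<bullet> v) / exp (\<phi> q)"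
  proof -
    have "v \<in> tangent_space" using velocity_tangent[OF \<gamma>, of 0] by (simp add: v_def)
    then have "\<psi>' x (d\<xi> q v) = v" using \<psi>'_d\<xi>[OF q] by (simp add: x_def)
    then show ?thesis
      using metric_form_symmetric[OF x(1), of "d\<xi> q u" "d\<xi> q v"] B_\<psi>[OF x(1)] x(2)
      by (simp add: inner_q_def riemannian_inner_eq[OF q] x_def[symmetric] metric_form_def h_def)
  qed
  have vel: "velocity (\<lambda>s. B (\<xi> (\<gamma>d s))) 0 = h"
    using velocity_B_curve[OF \<gamma>d, of 0] d\<xi>_velocity[OF \<gamma>d, of 0] assms(11)
    by (simp add: h_def x_def u_def)
  obtain m where m: "0 < m" "(support_vector \<phi> p \<bullet> r) / (support_vector \<phi> p \<bullet> q)
      - (support_vector \<phi> q \<bullet> r) / (support_vector \<phi> q \<bullet> q) = m * (h \<bullet> (r - q))"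
    using dual_geodesic_cross_ratio[OF dual r] vel assms(11,12) B[OF p] B[OF q] by metis
  obtain k where k: "0 < k" "(r - q) \<bullet> h = k * (v \<bullet> h)"
    using primal_geodesic_direction[OF primal, of h] assms(14,15) by (metis v_def)
  define c where "c = m * k * exp (\<phi> q)"
  have c: "0 < c" using m k by (simp add: c_def)
  have ratio: "(support_vector \<phi> q \<bullet> r) / (support_vector \<phi> q \<bullet> q)
      - (support_vector \<phi> p \<bullet> r) / (support_vector \<phi> p \<bullet> q) = c * inner_q"
    using m(2) k(2) by (simp add: inner_h c_def inner_commute)
  have diff: "diff = ln ((support_vector \<phi> q \<bullet> r) / (support_vector \<phi> q \<bullet> q))
      - ln ((support_vector \<phi> p \<bullet> r) / (support_vector \<phi> p \<bullet> q))"
    using pos[OF q r] pos[OF p r] pos[OF p q] p q r support_vector_self[OF smooth q]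
    by (simp add: diff_def L_divergence_eq[OF smooth] ln_div)
  have diff_sign: "(0 < diff \<longleftrightarrow> 0 < inner_q) \<and> (diff = 0 \<longleftrightarrow> inner_q = 0) \<and> (diff < 0 \<longleftrightarrow> inner_q < 0)"
  proof -
    let ?a = "(support_vector \<phi> q \<bullet> r) / (support_vector \<phi> q \<bullet> q)"
    let ?b = "(support_vector \<phi> p \<bullet> r) / (support_vector \<phi> p \<bullet> q)"
    have ab: "0 < ?a" "0 < ?b" using pos p q r by auto
    have "0 < diff \<longleftrightarrow> 0 < c * inner_q" "diff = 0 \<longleftrightarrow> c * inner_q = 0" "diff < 0 \<longleftrightarrow> c * inner_q < 0"
      unfolding diff ratio[symmetric] using ab by auto
    with c show ?thesis by (auto simp: zero_less_mult_iff mult_less_0_iff)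
  qed
  have "(angle_q < pi / 2 \<longleftrightarrow> 0 < inner_q) \<and> (angle_q = pi / 2 \<longleftrightarrow> inner_q = 0) \<and> (pi / 2 < angle_q \<longleftrightarrow> inner_q < 0)"
    unfolding angle_q_def inner_q_def riemannian_angle_def riemannian_inner_eq[OF q] x_def[symmetric]
  proof (rule arccos_quotient_cases)
    show "(metric_form x (d\<xi> q u) (d\<xi> q v))\<^sup>2 \<le> metric_form x (d\<xi> q u) (d\<xi> q u) * metric_form x (d\<xi> q v) (d\<xi> q v)"
      using x by (intro cauchy_schwarz_bilinear linear_metric_form metric_form_symmetric metric_form_positive)
    show "0 \<le> metric_form x w w" for w
      using metric_form_positive[OF x(1), of w] linear_0[OF linear_metric_form[OF x(1)], of 0] by (cases "w = 0") auto
    then show "0 \<le> metric_form x (d\<xi> q v) (d\<xi> q v)" .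
  qed
  with diff_sign show ?thesis
    unfolding Let_def diff_def inner_q_def angle_q_def u_def v_def by argo
qed

end
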